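(* For every prime number $l$ and all real $x>0$, $y>0$ with $x\neq y$, $$\mathcal{HZ}|_{\theta_l}(x,y)\equiv (l+1)\,\mathcal{HZ}(x,y)+\frac{l-1}{2}\log(l)\log\left(\frac{x}{y}\right)\mod \zeta(2),$$ i.e. the difference of the two sides lies in $\zeta(2)\mathbb{Z}$, where $\zeta(2)=\pi^2/6$.
   Context: **Herglotz-Zagier functions.** For $x\in\mathbb{C}\setminus(-\infty,0]$ put $HZ(x)=\sum_{n=1}^\infty \frac1n\left(\psi(nx)-\log(nx)\right)$, where $\psi$ is the digamma function, and $$\widetilde{HZ}(x)=HZ(x)-HZ(1)+\frac{\pi^2}{12}\left(x-2+x^{-1}\right)-\frac{\log^2 x}{4}.$$ Let $\mathrm{Li}_2(x)=\sum_{n\ge1}x^n/n^2$. The Rogers dilogarithm $L:\mathbb{R}_{>0}\setminus\{1\}\to\mathbb{R}$ is $L(x)=\mathrm{Li}_2(x)+\frac12\log(x)\log(1-x)$ for $0<x<1$ and $L(x)=\frac{\pi^2}{3}-L(1/x)$ for $x>1$. The refined Herglotz-Zagier function is $$\mathcal{HZ}(x,y)=\widetilde{HZ}(x)-\widetilde{HZ}(y)+L\left(\frac{y}{x}\right)\qquad(x>0,\ y>0,\ x\ne y).$$ **The set $S_l$ and the slash operation.** Let $$S_l=\left\{\begin{pmatrix}a&b\\c&d\end{pmatrix}\in \mathrm{M}_2(\mathbb{Z}) : 0\le b<a,\ 0\le c<d,\ ad-bc=l\right\},\qquad \theta_l=\sum_{M\in S_l}M\in\mathbb{Z}[S_l].$$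 For a complex-valued function $f(x_1,\dots,x_n)$ and $M=\begin{pmatrix}a&b\\c&d\end{pmatrix}$ define $$f|_M(x_1,\dots,x_n)=f\left(\frac{ax_1+c}{bx_1+d},\dots,\frac{ax_n+c}{bx_n+d}\right),\qquad f|_{\theta_l}=\sum_{M\in S_l}f|_M .$$ *)

theory Defs
  imports "HOL-Analysis.Analysis"
begin

text \<open>
  The Herglotz--Zagier function and its normalisation. They are only meaningful for
  \<open>x \<notin> \<real>\<^sub>\<le>\<^sub>0\<close>; the logarithm is the principal branch. The series index is shifted by one.
\<close>

definition HZ :: "complex \<Rightarrow> complex" where
  "HZ x = (\<Sum>n. (Digamma (of_nat (Suc n) * x) - Ln (of_nat (Suc n) * x)) / of_nat (Suc n))"

definition HZ_tilde :: "complex \<Rightarrow> complex" where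
  "HZ_tilde x = HZ x - HZ 1 + of_real (pi\<^sup>2 / 12) * (x - 2 + inverse x) - (Ln x)\<^sup>2 / 4"

definition Li2 :: "real \<Rightarrow> real" where
  "Li2 x = (\<Sum>n. x ^ Suc n / (real (Suc n))\<^sup>2)"

text \<open>The Rogers dilogarithm; only meaningful for \<open>x > 0\<close>, \<open>x \<noteq> 1\<close>.\<close>

definition rogers_L :: "real \<Rightarrow> real" where
  "rogers_L x =
     (if x < 1 then Li2 x + ln x * ln (1 - x) / 2
      else pi\<^sup>2 / 3 - (Li2 (1 / x) + ln (1 / x) * ln (1 - 1 / x) / 2))"

lemma rogers_L_gt_1: "x > 1 \<Longrightarrow> rogers_L x = pi\<^sup>2 / 3 - rogers_L (1 / x)"
  by (simp add: rogers_L_def)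

definition refined_HZ :: "real \<Rightarrow> real \<Rightarrow> complex" where
  "refined_HZ x y =
     HZ_tilde (of_real x) - HZ_tilde (of_real y) + of_real (rogers_L (y / x))"

text \<open>
  A matrix with rows \<open>(a, b)\<close> and \<open>(c, d)\<close> has \<open>a = M $ 1 $ 1\<close>, \<open>b = M $ 1 $ 2\<close>,
  \<open>c = M $ 2 $ 1\<close>, \<open>d = M $ 2 $ 2\<close>.
\<close>

definition S_set :: "nat \<Rightarrow> (int ^ 2 ^ 2) set" where
  "S_set l = {M. 0 \<le> M $ 1 $ 2 \<and> M $ 1 $ 2 < M $ 1 $ 1 \<and>
                 0 \<le> M $ 2 $ 1 \<and> M $ 2 $ 1 < M $ 2 $ 2 \<and> det M = int l}"

text \<open>
  Finiteness, so that the sum over \<open>S_set l\<close> below is a genuine sum.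
\<close>

lemma finite_S_set: "finite (S_set l)"
proof -
  let ?e = "\<lambda>M :: int ^ 2 ^ 2. (M $ 1 $ 1, M $ 1 $ 2, M $ 2 $ 1, M $ 2 $ 2)"
  let ?I = "{0..int l}"
  have "?e ` S_set l \<subseteq> ?I \<times> ?I \<times> ?I \<times> ?I"
  proof (rule image_subsetI)
    fix M assume M: "M \<in> S_set l"
    define a b c d where "a = M $ 1 $ 1" "b = M $ 1 $ 2" "c = M $ 2 $ 1" "d = M $ 2 $ 2"
    note defs = this
    from M have bnd: "0 \<le> b" "b < a" "0 \<le> c" "c < d" and det: "a * d - b * c = int l"
      by (auto simp: S_set_def det_2 defs)
    have "b * c \<le> (a - 1) * c" and "a * (c + 1) \<le> a * d"
      using bnd by (auto intro: mult_right_mono mult_left_mono)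
    hence 1: "a + c \<le> int l" using det by (simp add: algebra_simps)
    have "b * c \<le> b * (d - 1)" and "(b + 1) * d \<le> a * d"
      using bnd by (auto intro: mult_right_mono mult_left_mono)
    hence 2: "b + d \<le> int l" using det by (simp add: algebra_simps)
    show "?e M \<in> ?I \<times> ?I \<times> ?I \<times> ?I"
      using 1 2 bnd by (simp add: defs)
  qed
  hence "finite (?e ` S_set l)"
    by (rule finite_subset) auto
  moreover have "inj ?e"
    by (auto intro!: injI simp: vec_eq_iff forall_2)
  ultimately show ?thesis
    using finite_imageD inj_on_subset by blast
qed

text \<open>
  The action is the one of the transposed matrix: \<open>x \<mapsto> (a x + c) / (b x + d)\<close>.
\<close>

definition moebius_tr :: "int ^ 2 ^ 2 \<Rightarrow> real \<Rightarrow> real" where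
  "moebius_tr M x =
     (of_int (M $ 1 $ 1) * x + of_int (M $ 2 $ 1)) / (of_int (M $ 1 $ 2) * x + of_int (M $ 2 $ 2))"

definition slash :: "(real \<Rightarrow> real \<Rightarrow> complex) \<Rightarrow> int ^ 2 ^ 2 \<Rightarrow> real \<Rightarrow> real \<Rightarrow> complex" where
  "slash f M x y = f (moebius_tr M x) (moebius_tr M y)"

definition slash_theta :: "(real \<Rightarrow> real \<Rightarrow> complex) \<Rightarrow> nat \<Rightarrow> real \<Rightarrow> real \<Rightarrow> complex" where
  "slash_theta f l x y = (\<Sum>M\<in>S_set l. slash f M x y)"

definition zeta :: "nat \<Rightarrow> real" where
  "zeta k = (\<Sum>n. 1 / real (Suc n) ^ k)"

lemma zeta_2: "zeta 2 = pi\<^sup>2 / 6"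
  using sums_unique[OF inverse_squares_sums] by (simp add: zeta_def add.commute)

end

theory Submission
  imports Defs "HOL-Number_Theory.Cong" "HOL-Real_Asymp.Real_Asymp"
begin

text \<open>
  Write a matrix \<open>M\<close> of \<open>S\<^sub>l\<close> as a pair of columns \<open>(a, c)\<close>, \<open>(b, d)\<close>. For fixed \<open>y\<close>, both sides of the
  claimed congruence are smooth functions of \<open>x > y\<close>. As \<open>x\<close> tends to \<open>y\<close>, the one-variable
  functions cancel and every dilogarithm tends to \<open>L(1) = \<zeta>(2)\<close>, so the difference of both
  sides tends to the integer multiple \<open>card S\<^sub>l - (l + 1)\<close> of \<open>\<zeta>(2)\<close>. It therefore suffices to
  show that this difference has derivative zero. The case \<open>x < y\<close> follows from the reflection formula for \<open>L\<close>.

  The derivative of \<open>HZ\<close> is \<open>\<Sum>n\<ge>1. \<psi>'(n x) - 1 / (n x)\<close>, a regularised version of the divergent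
  sum of \<open>(p x + q)\<^sup>-\<^sup>2\<close> over the lattice points with \<open>p \<ge> 1\<close>, \<open>q \<ge> 0\<close>. Substituting the Moebius
  transformation of \<open>M\<close> restricts this sum to the lattice points of the form
  \<open>n (a, c) + m (b, d)\<close> with \<open>n \<ge> 1\<close>, \<open>m \<ge> 0\<close>. As \<open>M\<close> runs through \<open>S\<^sub>l\<close>, these discrete cones
  cover every lattice point of the quadrant once, and the multiples of \<open>l\<close> another \<open>l\<close> times
  (\<open>count_cones\<close>). For the exponent \<open>2 + s\<close> with \<open>s > 0\<close> everything converges and this gives an
  exact identity (\<open>cone_zeta_hecke\<close>). Letting \<open>s \<rightarrow> 0\<close>, the pole of the zeta function at \<open>1\<close> turns
  the dependence on \<open>s\<close> of the factors in front of it into logarithms; the result is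
  \<open>deriv_HZ_hecke\<close>.

  The remaining terms, from the dilogarithm and from the elementary part of the one-variable
  function, are sums over \<open>M\<close> of differences \<open>g (a, c) - g (b, d)\<close>. Such sums telescope: the matrices
  with \<open>b > 0\<close> are in bijection with those with \<open>c > 0\<close> in such a way that the second column of
  a matrix is the first column of its successor (\<open>bij_betw_next_quad\<close>), so that only the matrices
  with \<open>b = 0\<close> or \<open>c = 0\<close> contribute, and for prime \<open>l\<close> these are explicit. The counting of
  cones is an instance of the same telescoping.
\<close>

section \<open>Telescoping sums over reduced matrices\<close>

text \<open>
  The matrices with rows \<open>(a, b)\<close> and \<open>(c, d)\<close> over which the Hecke operator sums, as quadruples.
\<close>

definition reduced_quads :: "nat \<Rightarrow> (int \<times> int \<times> int \<times> int) set" where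
  "reduced_quads l = {(a, b, c, d). 0 \<le> b \<and> b < a \<and> 0 \<le> c \<and> c < d \<and> a * d - b * c = int l}"

lemma finite_reduced: "finite (reduced_quads l)"
proof -
  let ?I = "{0..int l}"
  have "reduced_quads l \<subseteq> ?I \<times> ?I \<times> ?I \<times> ?I"
  proof
    fix M assume "M \<in> reduced_quads l"
    then obtain a b c d where M: "M = (a, b, c, d)"
      and bnd: "0 \<le> b" "b < a" "0 \<le> c" "c < d" and det: "a * d - b * c = int l"
      by (auto simp: reduced_quads_def)
    \<comment> \<open>The determinant is at least \<open>a + c\<close> and at least \<open>b + d\<close>.\<close>
    have "b * c \<le> (a - 1) * c" and "a * (c + 1) \<le> a * d"
      using bnd by (auto intro: mult_right_mono mult_left_mono)
    hence 1: "a + c \<le> int l" using det by (simp add: algebra_simps)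
    have "b * c \<le> b * (d - 1)" and "(b + 1) * d \<le> a * d"
      using bnd by (auto intro: mult_right_mono mult_left_mono)
    hence 2: "b + d \<le> int l" using det by (simp add: algebra_simps)
    show "M \<in> ?I \<times> ?I \<times> ?I \<times> ?I" using 1 2 bnd by (simp add: M)
  qed
  thus ?thesis by (rule finite_subset) auto
qed

text \<open>
  The successor of a matrix has the columns \<open>v\<^sub>2\<close> and \<open>k v\<^sub>2 - v\<^sub>1\<close>, where \<open>k = \<lceil>a / b\<rceil>\<close> is the only
  multiplier that brings the new upper right entry \<open>k b - a\<close> into the range \<open>{0..<b}\<close>. The new columns span
  the same lattice as the old ones. Reading the quadruples backwards, that is, exchanging both the rows and the
  columns, turns successors into predecessors.
\<close>

definition next_quad :: "int \<times> int \<times> int \<times> int \<Rightarrow> int \<times> int \<times> int \<times> int" where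
  "next_quad = (\<lambda>(a, b, c, d). (b, (- a) mod b, d, - ((- a) div b) * d - c))"

definition prev_quad :: "int \<times> int \<times> int \<times> int \<Rightarrow> int \<times> int \<times> int \<times> int" where
  "prev_quad = (\<lambda>(a, b, c, d). (- ((- d) div c) * a - b, a, (- d) mod c, c))"

lemma quotient_ge_2:
  fixes a b :: int
  assumes "0 < b" "b < a"
  shows "- ((- a) div b) \<ge> 2"
proof (rule ccontr)
  assume "\<not> ?thesis"
  hence "(- 1) * b \<le> ((- a) div b) * b" using assms by (intro mult_right_mono) auto
  moreover have "((- a) div b) * b \<le> - a"
    using assms by (simp flip: minus_mod_eq_div_mult)
  ultimately show False using assms by simp
qed

text \<open>
  Applied to the second row of a successor, this finds the multiplier \<open>q\<close> again, because the old entry \<open>c\<close>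
  is itself a remainder modulo \<open>d\<close>; likewise for the first row of a predecessor.
\<close>

lemma quotient_recover:
  fixes c d q :: int
  assumes "0 \<le> c" "c < d"
  shows "(- (q * d - c)) div d = - q" "(- (q * d - c)) mod d = c"
proof -
  have eq: "- (q * d - c) = c + (- q) * d" by simp
  show "(- (q * d - c)) div d = - q" "(- (q * d - c)) mod d = c"
    unfolding eq using assms by (simp_all add: div_mult_self1 del: minus_mult_minus mult_minus_left)
qed

lemma next_quad_reduced:
  assumes "(a, b, c, d) \<in> reduced_quads l" "b > 0"
  shows "next_quad (a, b, c, d) \<in> reduced_quads l"
proof -
  define q where "q = - ((- a) div b)"
  have q: "(- a) mod b = q * b - a"
    by (simp add: q_def minus_div_mult_eq_mod [symmetric])
  have "q \<ge> 2" unfolding q_def using assms by (intro quotient_ge_2) (auto simp: reduced_quads_def)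
  hence "2 * d \<le> q * d" using assms by (intro mult_right_mono) (auto simp: reduced_quads_def)
  moreover have "c < d" using assms by (auto simp: reduced_quads_def)
  ultimately have "d < q * d - c" by linarith
  moreover have "(- a) mod b \<ge> 0" "(- a) mod b < b" using assms(2) by auto
  moreover have "b * (q * d - c) - (q * b - a) * d = int l"
    using assms by (simp add: reduced_quads_def algebra_simps)
  moreover have "next_quad (a, b, c, d) = (b, q * b - a, d, q * d - c)"
    unfolding next_quad_def prod.case q_def [symmetric] q ..
  ultimately show ?thesis
    using assms by (auto simp: reduced_quads_def q)
qed

lemma prev_quad_reduced:
  assumes "(a, b, c, d) \<in> reduced_quads l" "c > 0"
  shows "prev_quad (a, b, c, d) \<in> reduced_quads l"
proof -
  define q where "q = - ((- d) div c)"
  have q: "(- d) mod c = q * c - d"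
    by (simp add: q_def minus_div_mult_eq_mod [symmetric])
  have "q \<ge> 2" unfolding q_def using assms by (intro quotient_ge_2) (auto simp: reduced_quads_def)
  hence "2 * a \<le> q * a" using assms by (intro mult_right_mono) (auto simp: reduced_quads_def)
  moreover have "b < a" using assms by (auto simp: reduced_quads_def)
  ultimately have "a < q * a - b" by linarith
  moreover have "(- d) mod c \<ge> 0" "(- d) mod c < c" using assms(2) by auto
  moreover have "(q * a - b) * c - a * (q * c - d) = int l"
    using assms by (simp add: reduced_quads_def algebra_simps)
  moreover have "prev_quad (a, b, c, d) = (q * a - b, a, q * c - d, c)"
    unfolding prev_quad_def prod.case q_def [symmetric] q ..
  ultimately show ?thesis
    using assms by (auto simp: reduced_quads_def q)
qed

lemma bij_betw_next_quad:
  "bij_betw next_quad {(a, b, c, d) \<in> reduced_quads l. b > 0} {(a, b, c, d) \<in> reduced_quads l. c > 0}"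
proof (rule bij_betw_byWitness [where f' = prev_quad])
  show "\<forall>M\<in>{(a, b, c, d) \<in> reduced_quads l. b > 0}. prev_quad (next_quad M) = M"
  proof clarify
    fix a b c d assume *: "(a, b, c, d) \<in> reduced_quads l" "b > 0"
    hence cd: "0 \<le> c" "c < d" by (auto simp: reduced_quads_def)
    have "- ((- a) div b) * b - (- a) mod b = a"
      by (simp add: minus_div_mult_eq_mod [symmetric])
    thus "prev_quad (next_quad (a, b, c, d)) = (a, b, c, d)"
      unfolding next_quad_def prev_quad_def prod.case by (simp only: quotient_recover[OF cd] minus_minus)
  qed
  show "\<forall>M\<in>{(a, b, c, d) \<in> reduced_quads l. c > 0}. next_quad (prev_quad M) = M"
  proof clarify
    fix a b c d assume *: "(a, b, c, d) \<in> reduced_quads l" "c > 0"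
    hence ab: "0 \<le> b" "b < a" by (auto simp: reduced_quads_def)
    have "- ((- d) div c) * c - (- d) mod c = d"
      by (simp add: minus_div_mult_eq_mod [symmetric])
    thus "next_quad (prev_quad (a, b, c, d)) = (a, b, c, d)"
      unfolding next_quad_def prev_quad_def prod.case by (simp only: quotient_recover[OF ab] minus_minus)
  qed
  show "next_quad ` {(a, b, c, d) \<in> reduced_quads l. b > 0} \<subseteq> {(a, b, c, d) \<in> reduced_quads l. c > 0}"
  proof clarify
    fix a b c d a' b' c' d'
    assume *: "(a, b, c, d) \<in> reduced_quads l" "b > 0" "(a', b', c', d') = next_quad (a, b, c, d)"
    thus "(a', b', c', d') \<in> reduced_quads l \<and> c' > 0"
      using next_quad_reduced[OF *(1,2)] by (auto simp: next_quad_def reduced_quads_def)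
  qed
  show "prev_quad ` {(a, b, c, d) \<in> reduced_quads l. c > 0} \<subseteq> {(a, b, c, d) \<in> reduced_quads l. b > 0}"
  proof clarify
    fix a b c d a' b' c' d'
    assume *: "(a, b, c, d) \<in> reduced_quads l" "c > 0" "(a', b', c', d') = prev_quad (a, b, c, d)"
    thus "(a', b', c', d') \<in> reduced_quads l \<and> b' > 0"
      using prev_quad_reduced[OF *(1,2)] by (auto simp: prev_quad_def reduced_quads_def)
  qed
qed

lemma prime_factorization_int:
  fixes a d :: int
  assumes "prime l" "0 < a" "0 < d" "a * d = int l"
  shows "a = 1 \<and> d = int l \<or> a = int l \<and> d = 1"
proof -
  have "nat a * nat d = l" using assms by (metis nat_int nat_mult_distrib order_less_imp_le)
  hence "nat a = 1 \<or> nat d = 1" using assms(1) by (metis prime_product)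
  hence "a = 1 \<or> d = 1" by auto
  thus ?thesis using assms by auto
qed

lemma reduced_prime_c_eq_0:
  assumes "prime l"
  shows "(a, b, c, d) \<in> reduced_quads l \<and> c = 0 \<longleftrightarrow>
           (a, b, c, d) = (1, 0, 0, int l) \<or> a = int l \<and> b \<in> {0..<int l} \<and> c = 0 \<and> d = 1"
  using prime_gt_1_nat[OF assms] prime_factorization_int[OF assms, of a d]
  by (auto simp: reduced_quads_def)

lemma reduced_prime_b_eq_0:
  assumes "prime l"
  shows "(a, b, c, d) \<in> reduced_quads l \<and> b = 0 \<longleftrightarrow>
           (a, b, c, d) = (int l, 0, 0, 1) \<or> a = 1 \<and> b = 0 \<and> c \<in> {0..<int l} \<and> d = int l"
  using prime_gt_1_nat[OF assms] prime_factorization_int[OF assms, of a d]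
  by (auto simp: reduced_quads_def)

text \<open>
  The terms \<open>F\<close> with \<open>c > 0\<close> cancel against the terms \<open>G\<close> with \<open>b > 0\<close> through the bijection with the
  successors. A matrix with \<open>b = 0\<close> or \<open>c = 0\<close> has \<open>a d = l\<close>, so for prime \<open>l\<close> only the matrices on the right-hand side are left.
\<close>

lemma sum_reduced_telescope:
  fixes F G :: "int \<times> int \<times> int \<times> int \<Rightarrow> 'a :: ab_group_add"
  assumes l: "prime l"
  assumes FG: "\<And>a b c d. (a, b, c, d) \<in> reduced_quads l \<Longrightarrow> b > 0 \<Longrightarrow> G (a, b, c, d) = F (next_quad (a, b, c, d))"
  shows "(\<Sum>M\<in>reduced_quads l. F M - G M) =
           F (1, 0, 0, int l) + (\<Sum>b\<in>{0..<int l}. F (int l, b, 0, 1))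
           - G (int l, 0, 0, 1) - (\<Sum>c\<in>{0..<int l}. G (1, 0, c, int l))"
proof -
  have l1: "l > 1" using l by (rule prime_gt_1_nat)
  define B where "B = {(a, b, c, d) \<in> reduced_quads l. b > 0}"
  define C where "C = {(a, b, c, d) \<in> reduced_quads l. c > 0}"
  define B0 where "B0 = insert (int l, 0, 0, 1) ((\<lambda>c. (1 :: int, 0 :: int, c, int l)) ` {0..<int l})"
  define C0 where "C0 = insert (1, 0, 0, int l) ((\<lambda>b. (int l, b, 0 :: int, 1 :: int)) ` {0..<int l})"
  have B0: "(a, b, c, d) \<in> B0 \<longleftrightarrow> (a, b, c, d) \<in> reduced_quads l \<and> b = 0" for a b c d
    unfolding reduced_prime_b_eq_0[OF l] B0_def by auto
  have C0: "(a, b, c, d) \<in> C0 \<longleftrightarrow> (a, b, c, d) \<in> reduced_quads l \<and> c = 0" for a b c d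
    unfolding reduced_prime_c_eq_0[OF l] C0_def by auto
  have nonneg: "b \<ge> 0 \<and> c \<ge> 0" if "(a, b, c, d) \<in> reduced_quads l" for a b c d
    using that by (auto simp: reduced_quads_def)
  have "(a, b, c, d) \<in> reduced_quads l \<longleftrightarrow> (a, b, c, d) \<in> B0 \<union> B"
    "(a, b, c, d) \<in> reduced_quads l \<longleftrightarrow> (a, b, c, d) \<in> C0 \<union> C" for a b c d
    using nonneg[of a b c d] unfolding Un_iff B0 C0 by (auto simp: B_def C_def)
  hence "M \<in> reduced_quads l \<longleftrightarrow> M \<in> B0 \<union> B" "M \<in> reduced_quads l \<longleftrightarrow> M \<in> C0 \<union> C" for M
    by (cases M; blast)+
  hence BC: "reduced_quads l = B0 \<union> B" "reduced_quads l = C0 \<union> C" by blast+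
  have fin: "finite B" "finite C" "finite B0" "finite C0"
    using finite_reduced[of l] BC by (metis finite_Un)+
  have "sum F (reduced_quads l) = sum F C0 + sum F C"
    unfolding BC(2) using fin by (rule_tac sum.union_disjoint) (auto simp: C_def C0_def)
  also have "sum F C = (\<Sum>M\<in>B. F (next_quad M))"
    unfolding B_def C_def by (rule sum.reindex_bij_betw [OF bij_betw_next_quad, symmetric])
  also have "\<dots> = sum G B"
    by (rule sum.cong) (auto simp: FG B_def)
  also have "sum F C0 = F (1, 0, 0, int l) + (\<Sum>b\<in>{0..<int l}. F (int l, b, 0, 1))"
    unfolding C0_def using l1 by (subst sum.insert) (auto simp: sum.reindex inj_on_def)
  moreover have "sum G (reduced_quads l) = sum G B0 + sum G B"
    unfolding BC(1) using fin by (rule_tac sum.union_disjoint) (auto simp: B_def B0_def)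
  moreover have "sum G B0 = G (int l, 0, 0, 1) + (\<Sum>c\<in>{0..<int l}. G (1, 0, c, int l))"
    unfolding B0_def using l1 by (subst sum.insert) (auto simp: sum.reindex inj_on_def)
  ultimately show ?thesis by (simp add: sum_subtractf)
qed

corollary sum_columns_telescope:
  fixes g :: "int \<Rightarrow> int \<Rightarrow> real"
  assumes "prime l"
  shows "(\<Sum>(a, b, c, d)\<in>reduced_quads l. g a c - g b d) =
           real l * g (int l) 0 + g 1 0 - g 0 1 - real l * g 0 (int l)"
  using sum_reduced_telescope[OF assms, of "\<lambda>(a, b, c, d). g b d" "\<lambda>(a, b, c, d). g a c"]
  by (simp add: next_quad_def case_prod_unfold)

section \<open>Lattice points in the cones of reduced matrices\<close>

text \<open>
  Only combinations of the columns with integer coefficients count, so this is a cone in the sublattice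
  spanned by the columns. It contains the ray of the first column but not the ray of the second one, so
  that the cones of a matrix and its successor are disjoint.
\<close>

definition quad_cone :: "int \<times> int \<times> int \<times> int \<Rightarrow> (int \<times> int) set" where
  "quad_cone = (\<lambda>(a, b, c, d). (\<lambda>(n, m). (a * n + b * m, c * n + d * m)) ` ({1..} \<times> {0..}))"

text \<open>
  By Cramer's rule the coefficients of \<open>(p, q)\<close> are \<open>n = (d p - b q) / l\<close> and \<open>m = (a q - c p) / l\<close>.
\<close>

lemma mem_cone_iff:
  assumes "(a, b, c, d) \<in> reduced_quads l" "l > 0"
  shows "(p, q) \<in> quad_cone (a, b, c, d) \<longleftrightarrow>
           int l dvd a * q - c * p \<and> int l dvd d * p - b * q \<and> a * q - c * p \<ge> 0 \<and> d * p - b * q > 0"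
proof
  assume "(p, q) \<in> quad_cone (a, b, c, d)"
  then obtain n m where nm: "n \<ge> 1" "m \<ge> 0" "p = a * n + b * m" "q = c * n + d * m"
    by (auto simp: quad_cone_def)
  have det: "a * d - b * c = int l" using assms by (auto simp: reduced_quads_def)
  have "a * q - c * p = (a * d - b * c) * m" "d * p - b * q = (a * d - b * c) * n"
    by (simp_all add: nm algebra_simps)
  thus "int l dvd a * q - c * p \<and> int l dvd d * p - b * q \<and> a * q - c * p \<ge> 0 \<and> d * p - b * q > 0"
    using nm assms(2) by (simp add: det)
next
  assume *: "int l dvd a * q - c * p \<and> int l dvd d * p - b * q \<and> a * q - c * p \<ge> 0 \<and> d * p - b * q > 0"
  have det: "a * d - b * c = int l" using assms by (auto simp: reduced_quads_def)
  from * obtain n m where nm: "a * q - c * p = int l * m" "d * p - b * q = int l * n"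
    by (auto elim!: dvdE)
  have "m \<ge> 0" "n \<ge> 1" using * assms(2) nm
    by (auto simp: zero_le_mult_iff zero_less_mult_iff)
  moreover have "int l * p = int l * (a * n + b * m)"
  proof -
    have "int l * (a * n + b * m) = a * (int l * n) + b * (int l * m)" by (simp add: algebra_simps)
    also have "\<dots> = (a * d - b * c) * p" unfolding nm [symmetric] by (simp add: algebra_simps)
    finally show ?thesis unfolding det by (rule sym)
  qed
  moreover have "int l * q = int l * (c * n + d * m)"
  proof -
    have "int l * (c * n + d * m) = c * (int l * n) + d * (int l * m)" by (simp add: algebra_simps)
    also have "\<dots> = (a * d - b * c) * q" unfolding nm [symmetric] by (simp add: algebra_simps)
    finally show ?thesis unfolding det by (rule sym)
  qed
  ultimately show "(p, q) \<in> quad_cone (a, b, c, d)"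
    using assms(2) by (force simp: quad_cone_def)
qed

lemma sum_linear_congruence:
  assumes "prime l"
  shows "(\<Sum>b\<in>{0..<int l}. of_bool (int l dvd p - b * q) :: int) =
           (if int l dvd q then if int l dvd p then int l else 0 else 1)"
proof (cases "int l dvd q")
  case True
  hence "int l dvd p - b * q \<longleftrightarrow> int l dvd p" for b
    by (simp add: dvd_diff_left_iff)
  thus ?thesis using True by simp
next
  case False
  hence cop: "coprime q (int l)"
    using assms by (metis coprime_commute prime_imp_coprime prime_nat_int_transfer)
  obtain r where r: "[q * r = 1] (mod int l)"
    using cong_solve_coprime_int[OF cop] by auto
  have l0: "int l > 0" using assms by (simp add: prime_gt_0_nat)
  have "int l dvd p - b * q \<longleftrightarrow> b = (r * p) mod int l" if "b \<in> {0..<int l}" for b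
  proof -
    have "int l dvd p - b * q \<longleftrightarrow> [q * b = p] (mod int l)"
      by (simp add: cong_iff_dvd_diff dvd_diff_commute mult.commute)
    also have "\<dots> \<longleftrightarrow> [q * b = q * (r * p)] (mod int l)"
    proof -
      have "[q * (r * p) = p] (mod int l)"
        using cong_mult[OF r cong_refl[of p]] by (simp add: mult.assoc)
      thus ?thesis by (meson cong_sym cong_trans)
    qed
    also have "\<dots> \<longleftrightarrow> [b = r * p] (mod int l)"
      using cop by (rule cong_mult_lcancel)
    also have "\<dots> \<longleftrightarrow> b = (r * p) mod int l"
      using that by (simp add: cong_def)
    finally show ?thesis .
  qed
  hence "(\<Sum>b\<in>{0..<int l}. of_bool (int l dvd p - b * q) :: int) =
         (\<Sum>b\<in>{0..<int l}. if b = (r * p) mod int l then 1 else 0)"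
    by (intro sum.cong) auto
  also have "\<dots> = 1" using l0 by (subst sum.delta) auto
  finally show ?thesis using False by simp
qed

text \<open>
  Membership in the cone means that \<open>(p, q)\<close> lies in the lattice spanned by the columns, which is shared by
  a matrix and its successor, and that its slope is between the slopes of the two columns. The second
  condition is a difference of a condition on the first column and the same condition on
  the second column, so the count telescopes. The second column of a matrix
  with \<open>b = 0\<close> is vertical and contributes nothing, as \<open>p \<ge> 1\<close>. The matrices with \<open>c = 0\<close> contribute the
  number of \<open>b\<close> with \<open>p \<equiv> b q\<close> modulo \<open>l\<close>, and one more if \<open>l\<close> divides \<open>q\<close>.
\<close>

lemma count_cones:
  assumes l: "prime l" and p: "p \<ge> 1" and q: "q \<ge> 0"
  shows "(\<Sum>M\<in>reduced_quads l. of_bool ((p, q) \<in> quad_cone M) :: int) =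
           1 + (if int l dvd p \<and> int l dvd q then int l else 0)"
proof -
  define I where "I = (\<lambda>a b c d. int l dvd a * q - c * p \<and> int l dvd d * p - b * q)"
  define F :: "int \<times> int \<times> int \<times> int \<Rightarrow> int"
    where "F = (\<lambda>(a, b, c, d). of_bool (I a b c d \<and> a * q - c * p \<ge> 0))"
  define G :: "int \<times> int \<times> int \<times> int \<Rightarrow> int"
    where "G = (\<lambda>(a, b, c, d). of_bool (I a b c d \<and> b * q - d * p \<ge> 0))"
  have l0: "l > 0" using l by (rule prime_gt_0_nat)
  have "of_bool ((p, q) \<in> quad_cone M) = F M - G M" if "M \<in> reduced_quads l" for M
  proof -
    obtain a b c d where M: "M = (a, b, c, d)" by (cases M)
    have red: "0 \<le> b" "b < a" "0 \<le> c" "c < d" "a * d - b * c = int l"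
      using that by (auto simp: M reduced_quads_def)
    \<comment> \<open>The slopes of the columns increase, so a slope above the second column is above the first one.\<close>
    have "a * q - c * p \<ge> 0" if *: "b * q - d * p \<ge> 0"
    proof -
      have "b * (a * q - c * p) = a * (b * q - d * p) + (a * d - b * c) * p"
        by (simp add: algebra_simps)
      also have "\<dots> > 0"
        unfolding red(5) using * red p l0 by (intro add_nonneg_pos mult_nonneg_nonneg mult_pos_pos) auto
      finally show ?thesis using red(1) by (simp add: zero_less_mult_iff)
    qed
    thus ?thesis
      unfolding M mem_cone_iff[OF that[unfolded M] l0] by (auto simp: F_def G_def I_def)
  qed
  hence "(\<Sum>M\<in>reduced_quads l. of_bool ((p, q) \<in> quad_cone M) :: int) = (\<Sum>M\<in>reduced_quads l. F M - G M)"
    by (rule sum.cong [OF refl])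
  also have "\<dots> = F (1, 0, 0, int l) + (\<Sum>b\<in>{0..<int l}. F (int l, b, 0, 1))
           - G (int l, 0, 0, 1) - (\<Sum>c\<in>{0..<int l}. G (1, 0, c, int l))"
  proof (rule sum_reduced_telescope[OF l])
    fix a b c d assume "(a, b, c, d) \<in> reduced_quads l" "b > 0"
    define k where "k = - ((- a) div b)"
    have k: "(- a) mod b = k * b - a"
      by (simp add: k_def minus_div_mult_eq_mod [symmetric])
    have eq: "(k * d - c) * p - (k * b - a) * q = k * (d * p - b * q) + (a * q - c * p)"
      by (simp add: algebra_simps)
    \<comment> \<open>The columns of the successor span the same lattice.\<close>
    have "I a b c d \<longleftrightarrow> I b (k * b - a) d (k * d - c)"
    proof -
      have "int l dvd d * p - b * q \<longleftrightarrow> int l dvd b * q - d * p" by (rule dvd_diff_commute)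
      moreover have "int l dvd k * (d * p - b * q) + (a * q - c * p) \<longleftrightarrow> int l dvd a * q - c * p"
        if "int l dvd d * p - b * q" using that by (simp add: dvd_add_right_iff)
      ultimately show ?thesis unfolding I_def eq by blast
    qed
    thus "G (a, b, c, d) = F (next_quad (a, b, c, d))"
      unfolding F_def G_def next_quad_def prod.case k k_def [symmetric] by simp
  qed
  also have "F (1, 0, 0, int l) = of_bool (int l dvd q)"
    using q by (simp add: F_def I_def)
  also have "(\<Sum>b\<in>{0..<int l}. F (int l, b, 0, 1)) = (\<Sum>b\<in>{0..<int l}. of_bool (int l dvd p - b * q))"
    using q by (simp add: F_def I_def)
  also have "G (int l, 0, 0, 1) = 0" using p by (simp add: G_def)
  also have "(\<Sum>c\<in>{0..<int l}. G (1, 0, c, int l)) = 0"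
    using p l0 by (intro sum.neutral) (auto simp: G_def mult_le_0_iff)
  finally show ?thesis by (simp add: sum_linear_congruence[OF l])
qed

section \<open>The Moebius action\<close>

definition quad_moebius :: "int \<times> int \<times> int \<times> int \<Rightarrow> real \<Rightarrow> real" where
  "quad_moebius = (\<lambda>(a, b, c, d) x. (of_int a * x + of_int c) / (of_int b * x + of_int d))"

lemma moebius_denominator_pos:
  assumes "(a, b, c, d) \<in> reduced_quads l" "x > 0"
  shows "of_int a * x + of_int c > (0 :: real)" "of_int b * x + of_int d > (0 :: real)"
proof -
  have red: "0 \<le> b" "b < a" "0 \<le> c" "c < d" using assms by (auto simp: reduced_quads_def)
  show "of_int a * x + of_int c > 0" using red assms(2) by (intro add_pos_nonneg mult_pos_pos) auto
  show "of_int b * x + of_int d > 0" using red assms(2) by (intro add_nonneg_pos mult_nonneg_nonneg) auto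
qed

lemma moebius_pos: "M \<in> reduced_quads l \<Longrightarrow> x > 0 \<Longrightarrow> quad_moebius M x > 0"
  using moebius_denominator_pos by (cases M) (simp add: quad_moebius_def)

lemma reduced_det:
  assumes "(a, b, c, d) \<in> reduced_quads l"
  shows "of_int a * of_int d - of_int b * of_int c = real l"
  using assms by (auto simp: reduced_quads_def simp flip: of_int_mult of_int_diff)

lemma moebius_strict_mono:
  assumes "M \<in> reduced_quads l" "l > 0" "0 < y" "y < x"
  shows "quad_moebius M y < quad_moebius M x"
proof -
  obtain a b c d where M: "M = (a, b, c, d)" by (cases M)
  have "(of_int a * x + of_int c) * (of_int b * y + of_int d) - (of_int a * y + of_int c) * (of_int b * x + of_int d)
          = (of_int a * of_int d - of_int b * of_int c) * (x - y)"
    by (simp add: algebra_simps)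
  also have "\<dots> > 0" unfolding reduced_det[OF assms(1)[unfolded M]] using assms by simp
  finally show ?thesis
    using moebius_denominator_pos[OF assms(1)[unfolded M], of x] moebius_denominator_pos[OF assms(1)[unfolded M], of y] assms
    by (simp add: M quad_moebius_def divide_less_eq pos_less_divide_eq field_simps)
qed

lemma moebius_has_derivative:
  assumes "(a, b, c, d) \<in> reduced_quads l" "x > 0"
  shows "(quad_moebius (a, b, c, d) has_field_derivative real l / (of_int b * x + of_int d)\<^sup>2) (at x)"
proof -
  have "of_int a * (of_int b * x + of_int d) - of_int b * (of_int a * x + of_int c) = real l"
    using reduced_det[OF assms(1)] by (simp add: algebra_simps)
  thus ?thesis
    unfolding quad_moebius_def prod.case using moebius_denominator_pos[OF assms]
    by (auto intro!: derivative_eq_intros simp: power2_eq_square mult.commute)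
qed

section \<open>The Hurwitz zeta function near its pole\<close>

definition hurwitz :: "real \<Rightarrow> real \<Rightarrow> real" where
  "hurwitz s y = (\<Sum>m. (y + real m) powr (- s))"

text \<open>
  The bounds that compare \<open>\<Sum>(y + m)\<^sup>-\<^sup>s\<close> with the integral of \<open>t\<^sup>-\<^sup>s\<close> term by term, so that the sum is
  estimated by a telescoping series.
\<close>

lemma powr_difference_bounds:
  fixes r u :: real
  assumes "r > 0" "u > 0"
  shows "r * (u + 1) powr (- r - 1) \<le> u powr (- r) - (u + 1) powr (- r)"
    and "u powr (- r) - (u + 1) powr (- r) \<le> r * u powr (- r - 1)"
proof -
  have "\<exists>z>u. z < u + 1 \<and> (u + 1) powr (- r) - u powr (- r) = (u + 1 - u) * (- r * z powr (- r - 1))"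
    using assms by (intro MVT2) (auto intro!: derivative_eq_intros)
  then obtain z where z: "u < z" "z < u + 1"
    "u powr (- r) - (u + 1) powr (- r) = r * z powr (- r - 1)" by auto
  have "(u + 1) powr (- r - 1) \<le> z powr (- r - 1)" "z powr (- r - 1) \<le> u powr (- r - 1)"
    using assms z by (auto intro!: powr_mono2')
  thus "r * (u + 1) powr (- r - 1) \<le> u powr (- r) - (u + 1) powr (- r)"
    and "u powr (- r) - (u + 1) powr (- r) \<le> r * u powr (- r - 1)"
    unfolding z(3) using assms by auto
qed

lemma powr_telescope_sums:
  fixes r y :: real
  assumes "r > 0" "y > 0"
  shows "(\<lambda>m. (y + real m) powr (- r) - (y + real m + 1) powr (- r)) sums (y powr (- r))"
proof -
  have "(\<lambda>m. (y + real m) powr (- r)) \<longlonglongrightarrow> 0"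
    by (rule tendsto_neg_powr [OF assms(1)[folded neg_less_0_iff_less]])
       (intro filterlim_tendsto_add_at_top [OF tendsto_const] filterlim_real_sequentially)
  from telescope_sums' [OF this] show ?thesis by (simp add: algebra_simps)
qed

lemma summable_hurwitz:
  fixes s y :: real
  assumes "s > 1" "y > 0"
  shows "summable (\<lambda>m. (y + real m) powr (- s))"
proof (rule summable_Suc_iff [THEN iffD1], rule summable_comparison_test')
  show "summable (\<lambda>m. ((y + real m) powr (- (s - 1)) - (y + real m + 1) powr (- (s - 1))) / (s - 1))"
    using powr_telescope_sums[of "s - 1" y] assms by (intro summable_divide) (auto simp: sums_iff)
  show "norm ((y + real (Suc m)) powr (- s)) \<le>
          ((y + real m) powr (- (s - 1)) - (y + real m + 1) powr (- (s - 1))) / (s - 1)" for m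
    using powr_difference_bounds(1)[of "s - 1" "y + real m"] assms
    by (simp add: field_simps)
qed

lemma hurwitz_bounds:
  fixes s y :: real
  assumes "s > 1" "y > 0"
  shows "y powr (1 - s) / (s - 1) \<le> hurwitz s y"
    and "hurwitz s y \<le> y powr (1 - s) / (s - 1) + y powr (- s)"
proof -
  have T: "(\<lambda>m. ((y + real m) powr (- (s - 1)) - (y + real m + 1) powr (- (s - 1))) / (s - 1)) sums
             (y powr (- (s - 1)) / (s - 1))"
    using assms by (intro sums_divide powr_telescope_sums) auto
  have H: "(\<lambda>m. (y + real m) powr (- s)) sums hurwitz s y"
    unfolding hurwitz_def using summable_hurwitz[OF assms] by (rule summable_sums)
  have "y powr (- (s - 1)) / (s - 1) \<le> hurwitz s y"
  proof (rule sums_le [OF _ T H])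
    show "((y + real m) powr (- (s - 1)) - (y + real m + 1) powr (- (s - 1))) / (s - 1)
            \<le> (y + real m) powr (- s)" for m
      using powr_difference_bounds(2)[of "s - 1" "y + real m"] assms
      by (simp add: field_simps)
  qed
  thus "y powr (1 - s) / (s - 1) \<le> hurwitz s y" by simp
  have H': "(\<lambda>m. (y + real (Suc m)) powr (- s)) sums (hurwitz s y - y powr (- s))"
    using H by (subst sums_Suc_iff) simp
  have "hurwitz s y - y powr (- s) \<le> y powr (- (s - 1)) / (s - 1)"
  proof (rule sums_le [OF _ H' T])
    show "(y + real (Suc m)) powr (- s) \<le>
            ((y + real m) powr (- (s - 1)) - (y + real m + 1) powr (- (s - 1))) / (s - 1)" for m
      using powr_difference_bounds(1)[of "s - 1" "y + real m"] assms
      by (simp add: field_simps)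
  qed
  thus "hurwitz s y \<le> y powr (1 - s) / (s - 1) + y powr (- s)" by simp
qed

lemma hurwitz_nonneg: "s > 1 \<Longrightarrow> y > 0 \<Longrightarrow> hurwitz s y \<ge> 0"
  by (rule order.trans [OF _ hurwitz_bounds(1)]) auto

lemma hurwitz_2:
  assumes "y > 0"
  shows "hurwitz 2 y = Polygamma 1 y"
proof -
  have "(\<Sum>m. (y + real m) powr (- 2)) = (\<Sum>m. inverse ((y + real m)\<^sup>2))"
    using assms by (intro suminf_cong) (simp add: powr_minus powr_numeral)
  thus ?thesis by (simp add: hurwitz_def Polygamma_def numeral_2_eq_2)
qed

text \<open>
  A majorant that is independent of \<open>s\<close>, for passing to the limit \<open>s \<rightarrow> 0\<close> under a sum.
\<close>

lemma powr_le_add_powr: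
  fixes u s k :: real
  assumes "u > 0" "0 \<le> s" "s \<le> 1"
  shows "u powr (- (k + s)) \<le> u powr (- k) + u powr (- (k + 1))"
proof (cases "u \<ge> 1")
  case True
  hence "u powr (- (k + s)) \<le> u powr (- k)" using assms by (intro powr_mono) auto
  thus ?thesis by (simp add: add_increasing2)
next
  case False
  hence "u powr (- (k + s)) \<le> u powr (- (k + 1))" using assms by (intro powr_mono') auto
  thus ?thesis by (simp add: add_increasing)
qed

lemma eventually_at_right_0_1: "eventually (\<lambda>s. 0 < s \<and> s < 1) (at_right (0 :: real))"
  by (rule eventually_at_rightI [of 0 1]) auto

lemma tendsto_hurwitz_2:
  assumes y: "y > 0"
  shows "((\<lambda>s. hurwitz (2 + s) y) \<longlongrightarrow> hurwitz 2 y) (at_right 0)"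
  unfolding hurwitz_def
proof (rule tannerys_theorem [THEN conjunct2, THEN conjunct2])
  show "((\<lambda>s. (y + real m) powr (- (2 + s))) \<longlongrightarrow> (y + real m) powr (- 2)) (at_right 0)" for m
    using y by (auto intro!: tendsto_eq_intros)
  show "summable (\<lambda>m. (y + real m) powr (- 2) + (y + real m) powr (- (2 + 1)))"
    using y by (intro summable_add summable_hurwitz) auto
  show "\<forall>\<^sub>F (m, s) in at_top \<times>\<^sub>F at_right 0.
           norm ((y + real m) powr (- (2 + s))) \<le> (y + real m) powr (- 2) + (y + real m) powr (- (2 + 1))"
    using eventually_prodI [OF always_eventually [of "\<lambda>_. True"] eventually_at_right_0_1, of sequentially]
          powr_le_add_powr[of "y + real _" _ 2] y
    by (auto elim!: eventually_mono)
qed auto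

text \<open>
  The residue of the Riemann zeta function at \<open>1\<close>.
\<close>

lemma tendsto_hurwitz_pole: "((\<lambda>s. s * hurwitz (1 + s) 1) \<longlongrightarrow> 1) (at_right 0)"
proof (rule tendsto_sandwich)
  show "\<forall>\<^sub>F s in at_right 0. 1 \<le> s * hurwitz (1 + s) 1"
    using eventually_at_right_0_1
    by eventually_elim (use hurwitz_bounds(1)[of "1 + _" 1] in \<open>force simp: field_simps\<close>)
  show "\<forall>\<^sub>F s in at_right 0. s * hurwitz (1 + s) 1 \<le> 1 + s"
    using eventually_at_right_0_1
    by eventually_elim (use hurwitz_bounds(2)[of "1 + _" 1] in \<open>force simp: field_simps\<close>)
qed (auto intro!: tendsto_eq_intros)

section \<open>The zeta function of the quadrant\<close>

text \<open>
  The sum of \<open>(p x + q)\<^sup>-\<^sup>s\<close> over the lattice points with \<open>p \<ge> 1\<close> and \<open>q \<ge> 0\<close>, summed over \<open>q\<close> first.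
  It converges for \<open>s > 2\<close>.
\<close>

definition cone_zeta :: "real \<Rightarrow> real \<Rightarrow> real" where
  "cone_zeta s x = (\<Sum>n. hurwitz s (real (Suc n) * x))"

lemma summable_Suc_mult_powr:
  fixes s x :: real
  assumes "s > 1" "x > 0"
  shows "summable (\<lambda>n. (real (Suc n) * x) powr (- s))"
proof -
  have "summable (\<lambda>n. (1 + real n) powr (- s) * x powr (- s))"
    using assms by (intro summable_mult2 summable_hurwitz) auto
  thus ?thesis using assms by (simp add: powr_mult add_ac)
qed

lemma summable_cone_zeta:
  fixes s x :: real
  assumes "s > 2" "x > 0"
  shows "summable (\<lambda>n. hurwitz s (real (Suc n) * x))"
proof (rule summable_comparison_test')
  show "summable (\<lambda>n. (real (Suc n) * x) powr (- (s - 1)) / (s - 1) + (real (Suc n) * x) powr (- s))"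
    using assms by (intro summable_add summable_divide summable_Suc_mult_powr) auto
  show "norm (hurwitz s (real (Suc n) * x)) \<le>
          (real (Suc n) * x) powr (- (s - 1)) / (s - 1) + (real (Suc n) * x) powr (- s)" for n
    using hurwitz_bounds(2)[of s "real (Suc n) * x"] hurwitz_nonneg[of s "real (Suc n) * x"] assms
    by (simp del: of_nat_Suc)
qed

text \<open>
  What is left at \<open>s = 0\<close> once the pole is removed. The leading term \<open>y\<^sup>-\<^sup>1\<^sup>-\<^sup>s / (1 + s)\<close> of the inner sum at \<open>y = n x\<close>
  is the integral of \<open>t\<^sup>-\<^sup>2\<^sup>-\<^sup>s\<close> from \<open>y\<close> to infinity. It is this term whose sum over \<open>n\<close> produces the
  pole; the remainder is at most \<open>y\<^sup>-\<^sup>2\<^sup>-\<^sup>s\<close>, so that the limit can be taken term by term.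
\<close>

lemma tendsto_cone_zeta:
  assumes x: "x > 0"
  shows "((\<lambda>s. cone_zeta (2 + s) x - x powr (- 1 - s) * hurwitz (1 + s) 1 / (1 + s)) \<longlongrightarrow>
            (\<Sum>n. Polygamma 1 (real (Suc n) * x) - 1 / (real (Suc n) * x))) (at_right 0)"
proof -
  have "((\<lambda>s. \<Sum>n. hurwitz (2 + s) (real (Suc n) * x) - (real (Suc n) * x) powr (- 1 - s) / (1 + s)) \<longlongrightarrow>
          (\<Sum>n. hurwitz 2 (real (Suc n) * x) - (real (Suc n) * x) powr (- 1) / 1)) (at_right 0)"
  proof (rule tannerys_theorem [THEN conjunct2, THEN conjunct2])
    show "((\<lambda>s. hurwitz (2 + s) (real (Suc n) * x) - (real (Suc n) * x) powr (- 1 - s) / (1 + s)) \<longlongrightarrow>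
             hurwitz 2 (real (Suc n) * x) - (real (Suc n) * x) powr (- 1) / 1) (at_right 0)" for n
      using x by (intro tendsto_diff tendsto_hurwitz_2) (auto intro!: tendsto_eq_intros simp del: of_nat_Suc)
    show "summable (\<lambda>n. (real (Suc n) * x) powr (- 2) + (real (Suc n) * x) powr (- (2 + 1)))"
      using x by (intro summable_add summable_Suc_mult_powr) auto
    have "norm (hurwitz (2 + s) u - u powr (- 1 - s) / (1 + s)) \<le> u powr (- 2) + u powr (- (2 + 1))"
      if "0 < s" "s < 1" "u > 0" for s u :: real
      using hurwitz_bounds[of "2 + s" u] powr_le_add_powr[of u s 2] that by simp
    thus "\<forall>\<^sub>F (n, s) in at_top \<times>\<^sub>F at_right 0.
           norm (hurwitz (2 + s) (real (Suc n) * x) - (real (Suc n) * x) powr (- 1 - s) / (1 + s))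
             \<le> (real (Suc n) * x) powr (- 2) + (real (Suc n) * x) powr (- (2 + 1))"
      using eventually_prodI [OF always_eventually [of "\<lambda>_. True"] eventually_at_right_0_1, of sequentially] x
      by (auto elim!: eventually_mono simp del: of_nat_Suc)
  qed auto
  also have "(\<Sum>n. hurwitz 2 (real (Suc n) * x) - (real (Suc n) * x) powr (- 1) / 1) =
               (\<Sum>n. Polygamma 1 (real (Suc n) * x) - 1 / (real (Suc n) * x))"
    using x by (intro suminf_cong) (simp add: hurwitz_2 powr_minus divide_inverse del: of_nat_Suc)
  finally show ?thesis
  proof (rule Lim_transform_eventually)
    show "\<forall>\<^sub>F s in at_right 0.
            (\<Sum>n. hurwitz (2 + s) (real (Suc n) * x) - (real (Suc n) * x) powr (- 1 - s) / (1 + s)) =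
            cone_zeta (2 + s) x - x powr (- 1 - s) * hurwitz (1 + s) 1 / (1 + s)"
      using eventually_at_right_0_1
    proof eventually_elim
      case (elim s)
      have "(\<lambda>n. (1 + real n) powr (- (1 + s))) sums hurwitz (1 + s) 1"
        unfolding hurwitz_def using elim by (intro summable_sums summable_hurwitz) auto
      hence "(\<lambda>n. (1 + real n) powr (- (1 + s)) * (x powr (- 1 - s) / (1 + s))) sums
               (hurwitz (1 + s) 1 * (x powr (- 1 - s) / (1 + s)))"
        by (rule sums_mult2)
      moreover have "(1 + real n) powr (- (1 + s)) * (x powr (- 1 - s) / (1 + s)) =
                       (real (Suc n) * x) powr (- 1 - s) / (1 + s)" for n
        using x by (simp add: powr_mult add_ac)
      ultimately have "(\<lambda>n. (real (Suc n) * x) powr (- 1 - s) / (1 + s)) sums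
               (x powr (- 1 - s) * hurwitz (1 + s) 1 / (1 + s))" by (simp only: mult_ac times_divide_eq_right)
      moreover have "(\<lambda>n. hurwitz (2 + s) (real (Suc n) * x)) sums cone_zeta (2 + s) x"
        unfolding cone_zeta_def using elim x by (intro summable_sums summable_cone_zeta) auto
      ultimately show ?case by (intro sums_unique [symmetric] sums_diff)
    qed
  qed
qed

lemma cone_zeta_has_sum:
  assumes "s > 2" "x > 0"
  shows "((\<lambda>(p, q). (of_int p * x + of_int q) powr (- s)) has_sum cone_zeta s x) ({1 :: int..} \<times> {0 :: int..})"
proof -
  let ?f = "\<lambda>(n, m). (real (Suc n) * x + real m) powr (- s)"
  have row: "((\<lambda>m. ?f (n, m)) has_sum hurwitz s (real (Suc n) * x)) UNIV" for n
  proof (rule sums_nonneg_imp_has_sum)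
    show "(\<lambda>m. ?f (n, m)) sums hurwitz s (real (Suc n) * x)"
      unfolding hurwitz_def prod.case using assms by (intro summable_sums summable_hurwitz) auto
  qed auto
  have col: "((\<lambda>n. hurwitz s (real (Suc n) * x)) has_sum cone_zeta s x) UNIV"
  proof (rule sums_nonneg_imp_has_sum)
    show "(\<lambda>n. hurwitz s (real (Suc n) * x)) sums cone_zeta s x"
      unfolding cone_zeta_def using assms by (intro summable_sums summable_cone_zeta) auto
    show "hurwitz s (real (Suc n) * x) \<ge> 0" for n
      using assms by (intro hurwitz_nonneg) auto
  qed
  have "(?f has_sum cone_zeta s x) (Sigma UNIV (\<lambda>_. UNIV))"
  proof (rule has_sum_SigmaI [OF row col])
    show "?f summable_on Sigma UNIV (\<lambda>_. UNIV)"
      using row has_sum_imp_summable[OF col] by (rule summable_on_SigmaI) auto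
  qed
  also have "?this \<longleftrightarrow> ((\<lambda>(p, q). (of_int p * x + of_int q) powr (- s)) has_sum cone_zeta s x) ({1 :: int..} \<times> {0 :: int..})"
    by (rule has_sum_reindex_bij_witness [of _ "\<lambda>(p, q). (nat (p - 1), nat q)" "\<lambda>(n, m). (int (Suc n), int m)"])
       auto
  finally show ?thesis .
qed

text \<open>
  The point \<open>n v\<^sub>1 + m v\<^sub>2\<close> contributes \<open>(n (a x + c) + m (b x + d))\<^sup>-\<^sup>s\<close>, from which the factor
  \<open>(b x + d)\<^sup>-\<^sup>s\<close> can be taken out by homogeneity.
\<close>

lemma cone_has_sum:
  assumes M: "(a, b, c, d) \<in> reduced_quads l" "l > 0" and s: "s > 2" and x: "x > 0"
  shows "((\<lambda>(p, q). (of_int p * x + of_int q) powr (- s)) has_sum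
           ((of_int b * x + of_int d) powr (- s) * cone_zeta s (quad_moebius (a, b, c, d) x)))
         (quad_cone (a, b, c, d))"
proof -
  define X where "X = of_int a * x + of_int c"
  define X' where "X' = of_int b * x + of_int d"
  have red: "0 \<le> b" "b < a" "0 \<le> c" "c < d" "a * d - b * c = int l"
    using M by (auto simp: reduced_quads_def)
  have X: "X > 0" "X' > 0"
    unfolding X_def X'_def using moebius_denominator_pos[OF M(1) x] by auto
  have inj: "inj_on (\<lambda>(n, m). (a * n + b * m, c * n + d * m)) ({1..} \<times> {0..})"
  proof (rule inj_onI, clarify)
    fix n m n' m' :: int
    assume *: "a * n + b * m = a * n' + b * m'" "c * n + d * m = c * n' + d * m'"
    have "(a * d - b * c) * (n - n') = 0" "(a * d - b * c) * (m - m') = 0"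
      using * by algebra+
    thus "n = n' \<and> m = m'" using M(2) by (simp add: red(5))
  qed
  have "((\<lambda>(p, q). (of_int p * (X / X') + of_int q) powr (- s)) has_sum cone_zeta s (X / X')) ({1 :: int..} \<times> {0 :: int..})"
    using s X by (intro cone_zeta_has_sum) auto
  hence "((\<lambda>P. X' powr (- s) * (\<lambda>(p, q). (of_int p * (X / X') + of_int q) powr (- s)) P) has_sum (X' powr (- s) * cone_zeta s (X / X')))
           ({1 :: int..} \<times> {0 :: int..})" by (rule has_sum_cmult_right)
  also have "?this \<longleftrightarrow> (((\<lambda>(p, q). (of_int p * x + of_int q) powr (- s)) \<circ> (\<lambda>(n, m). (a * n + b * m, c * n + d * m)))
                 has_sum (X' powr (- s) * cone_zeta s (X / X'))) ({1 :: int..} \<times> {0 :: int..})"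
  proof (rule has_sum_cong)
    fix P assume "P \<in> {1 :: int..} \<times> {0 :: int..}"
    then obtain n m where P: "P = (n, m)" and nm: "n \<in> {1..}" "m \<in> {0..}" by auto
    have "of_int n * (X / X') + of_int m \<ge> 0" using nm X by (intro add_nonneg_nonneg mult_nonneg_nonneg) auto
    hence "X' powr (- s) * (of_int n * (X / X') + of_int m) powr (- s) =
             (X' * (of_int n * (X / X') + of_int m)) powr (- s)"
      using X by (simp add: powr_mult)
    also have "X' * (of_int n * (X / X') + of_int m) = of_int n * X + of_int m * X'"
      using X by (simp add: field_simps)
    also have "\<dots> = of_int (a * n + b * m) * x + of_int (c * n + d * m)"
      by (simp add: X_def X'_def algebra_simps)
    finally show "X' powr (- s) * (\<lambda>(p, q). (of_int p * (X / X') + of_int q) powr (- s)) P =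
            ((\<lambda>(p, q). (of_int p * x + of_int q) powr (- s)) \<circ> (\<lambda>(n, m). (a * n + b * m, c * n + d * m))) P"
      by (simp add: P)
  qed
  also have "\<dots> \<longleftrightarrow> ((\<lambda>(p, q). (of_int p * x + of_int q) powr (- s)) has_sum (X' powr (- s) * cone_zeta s (X / X')))
                (quad_cone (a, b, c, d))"
    unfolding quad_cone_def prod.case by (rule has_sum_reindex [OF inj, symmetric])
  finally show ?thesis unfolding X_def X'_def quad_moebius_def prod.case .
qed

lemma has_sum_sum:
  fixes f :: "'a \<Rightarrow> 'b \<Rightarrow> 'c :: topological_comm_monoid_add"
  assumes "finite I" "\<And>i. i \<in> I \<Longrightarrow> (f i has_sum S i) A"
  shows "((\<lambda>x. \<Sum>i\<in>I. f i x) has_sum (\<Sum>i\<in>I. S i)) A"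
  using assms by (induction I rule: finite_induct) (auto intro!: has_sum_add has_sum_0)

text \<open>
  The sum of the zeta functions of the cones counts every lattice point once and the points of the lattice
  \<open>l \<int>\<^sup>2\<close> another \<open>l\<close> times; by homogeneity the latter contribute \<open>l\<^sup>1\<^sup>-\<^sup>s\<close> times the sum over all points.
\<close>

lemma cone_zeta_hecke:
  assumes l: "prime l" and s: "s > 2" and x: "x > 0"
  shows "(\<Sum>(a, b, c, d)\<in>reduced_quads l. (of_int b * x + of_int d) powr (- s)
             * cone_zeta s (quad_moebius (a, b, c, d) x))
           = (1 + real l powr (1 - s)) * cone_zeta s x"
proof -
  have l0: "l > 0" using l by (rule prime_gt_0_nat)
  define K where "K = {1 :: int..} \<times> {0 :: int..}"
  define f where "f = (\<lambda>(p, q). (of_int p * x + of_int q) powr (- s))"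
  define V where "V = (\<lambda>(a, b, c, d). (of_int b * x + of_int d) powr (- s)
             * cone_zeta s (quad_moebius (a, b, c, d) x))"
  have "((\<lambda>P. of_bool (P \<in> quad_cone M) * f P) has_sum V M) K" if "M \<in> reduced_quads l" for M
  proof -
    obtain a b c d where M: "M = (a, b, c, d)" by (cases M)
    have red: "0 \<le> b" "b < a" "0 \<le> c" "c < d"
      using that by (auto simp: M reduced_quads_def)
    have "quad_cone M \<subseteq> K"
    proof -
      have "a * n + b * m \<ge> 1 \<and> c * n + d * m \<ge> 0" if "n \<ge> 1" "m \<ge> 0" for n m
      proof -
        have "1 * 1 \<le> a * n" using red that by (intro mult_mono) auto
        moreover have "0 \<le> b * m" "0 \<le> c * n" "0 \<le> d * m" using red that by auto
        ultimately show ?thesis by linarith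
      qed
      thus ?thesis by (auto simp: quad_cone_def M K_def)
    qed
    moreover have "(f has_sum V M) (quad_cone M)"
      using cone_has_sum[OF that[unfolded M] l0 s x] by (simp add: f_def V_def M)
    ultimately show ?thesis
      using has_sum_cong_neutral[of K "quad_cone M" "\<lambda>P. of_bool (P \<in> quad_cone M) * f P" f "V M"] by auto
  qed
  hence "((\<lambda>P. \<Sum>M\<in>reduced_quads l. of_bool (P \<in> quad_cone M) * f P) has_sum (\<Sum>M\<in>reduced_quads l. V M)) K"
    by (intro has_sum_sum finite_reduced)
  also have "?this \<longleftrightarrow> ((\<lambda>P. f P + of_bool (int l dvd fst P \<and> int l dvd snd P) * (real l * f P))
                         has_sum (\<Sum>M\<in>reduced_quads l. V M)) K"
  proof (rule has_sum_cong)
    fix P assume "P \<in> K"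
    then obtain p q where P: "P = (p, q)" "p \<ge> 1" "q \<ge> 0" by (auto simp: K_def)
    have "(\<Sum>M\<in>reduced_quads l. of_bool (P \<in> quad_cone M) * f P) =
            of_int (\<Sum>M\<in>reduced_quads l. of_bool (P \<in> quad_cone M)) * f P"
      by (simp add: sum_distrib_right)
    also have "\<dots> = f P + of_bool (int l dvd fst P \<and> int l dvd snd P) * (real l * f P)"
      unfolding P(1) count_cones[OF l P(2,3)] by (simp add: algebra_simps)
    finally show "(\<Sum>M\<in>reduced_quads l. of_bool (P \<in> quad_cone M) * f P) =
                    f P + of_bool (int l dvd fst P \<and> int l dvd snd P) * (real l * f P)" .
  qed
  finally have 1: "((\<lambda>P. f P + of_bool (int l dvd fst P \<and> int l dvd snd P) * (real l * f P))
                         has_sum (\<Sum>M\<in>reduced_quads l. V M)) K" .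
  have f: "(f has_sum cone_zeta s x) K"
    unfolding f_def K_def using s x by (rule cone_zeta_has_sum)
  have "((\<lambda>P. real l powr (1 - s) * f P) has_sum (real l powr (1 - s) * cone_zeta s x)) K"
    using f by (rule has_sum_cmult_right)
  also have "?this \<longleftrightarrow> (((\<lambda>P. real l * f P) \<circ> (\<lambda>(p, q). (int l * p, int l * q))) has_sum (real l powr (1 - s) * cone_zeta s x)) K"
  proof (rule has_sum_cong)
    fix P assume "P \<in> K"
    then obtain p q where P: "P = (p, q)" "p \<ge> 1" "q \<ge> 0" by (auto simp: K_def)
    have "of_int p * x + of_int q \<ge> 0" using P x by simp
    hence "(real l * (of_int p * x + of_int q)) powr (- s) = real l powr (- s) * f P"
      using l0 by (simp add: f_def P powr_mult)
    moreover have "real l powr (1 - s) = real l * real l powr (- s)"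
      using l0 by (simp add: powr_diff powr_minus field_simps)
    ultimately have "real l powr (1 - s) * f P = real l * (real l * (of_int p * x + of_int q)) powr (- s)"
      by simp
    thus "real l powr (1 - s) * f P = ((\<lambda>P. real l * f P) \<circ> (\<lambda>(p, q). (int l * p, int l * q))) P"
      by (simp add: f_def P algebra_simps)
  qed
  also have "\<dots> \<longleftrightarrow> ((\<lambda>P. real l * f P) has_sum (real l powr (1 - s) * cone_zeta s x)) ((\<lambda>(p, q). (int l * p, int l * q)) ` K)"
    using l0 by (intro has_sum_reindex [symmetric]) (auto simp: inj_on_def)
  also have "\<dots> \<longleftrightarrow> ((\<lambda>P. of_bool (int l dvd fst P \<and> int l dvd snd P) * (real l * f P)) has_sum (real l powr (1 - s) * cone_zeta s x)) K"
  proof (rule has_sum_cong_neutral)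
    have sub: "P \<in> (\<lambda>(p, q). (int l * p, int l * q)) ` K"
      if "P \<in> K" "int l dvd fst P" "int l dvd snd P" for P
    proof -
      from that obtain p q where "P = (int l * p, int l * q)" "int l * p \<ge> 1" "int l * q \<ge> 0"
        by (cases P) (auto simp: K_def elim!: dvdE)
      moreover from this have "p \<ge> 1" "q \<ge> 0"
        using l0 by (auto simp: zero_le_mult_iff int_one_le_iff_zero_less zero_less_mult_iff)
      ultimately show ?thesis by (auto simp: K_def)
    qed
    show "of_bool (int l dvd fst P \<and> int l dvd snd P) * (real l * f P) = 0"
      if "P \<in> K - (\<lambda>(p, q). (int l * p, int l * q)) ` K" for P
      using that sub[of P] by (auto simp del: image_eqI)
    have "(int l * p, int l * q) \<in> K" if "(p, q) \<in> K" for p q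
      using that l0 by (auto simp: K_def int_one_le_iff_zero_less)
    thus "real l * f P = 0"
      if "P \<in> (\<lambda>(p, q). (int l * p, int l * q)) ` K - K" for P using that by auto
    show "real l * f P = of_bool (int l dvd fst P \<and> int l dvd snd P) * (real l * f P)"
      if "P \<in> (\<lambda>(p, q). (int l * p, int l * q)) ` K \<inter> K" for P using that by auto
  qed
  finally have "((\<lambda>P. f P + of_bool (int l dvd fst P \<and> int l dvd snd P) * (real l * f P))
                         has_sum (cone_zeta s x + real l powr (1 - s) * cone_zeta s x)) K"
    by (rule has_sum_add [OF f])
  with 1 have "(\<Sum>M\<in>reduced_quads l. V M) = cone_zeta s x + real l powr (1 - s) * cone_zeta s x"
    by (rule has_sum_unique)
  thus ?thesis by (simp add: V_def algebra_simps)
qed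

section \<open>The derivative of the Herglotz-Zagier function\<close>

text \<open>
  The mean value theorem for \<open>ln \<circ> \<Gamma>\<close> on \<open>[y, y + 1]\<close> represents \<open>ln y\<close> as a value of the increasing
  function \<open>\<psi>\<close> on this interval, and \<open>\<psi> (y + 1) = \<psi> y + 1 / y\<close>.
\<close>

lemma Digamma_bounds:
  fixes y :: real
  assumes "y > 0"
  shows "ln y - 1 / y \<le> Digamma y" "Digamma y \<le> ln y"
proof -
  have "\<exists>z>y. z < y + 1 \<and> ln_Gamma (y + 1) - ln_Gamma y = (y + 1 - y) * Digamma z"
    using assms by (intro MVT2) (auto intro!: derivative_eq_intros)
  then obtain z where z: "y < z" "z < y + 1" "ln_Gamma (y + 1) - ln_Gamma y = Digamma z" by auto
  have "Gamma (y + 1) = y * Gamma y"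
    using assms by (intro Gamma_plus1) (auto elim!: nonpos_Ints_cases)
  moreover have "Gamma y \<noteq> 0" using Gamma_real_pos[OF assms] by linarith
  ultimately have "ln_Gamma (y + 1) = ln y + ln_Gamma y"
    using assms by (simp add: ln_Gamma_real_pos ln_mult)
  hence ln: "ln y = Digamma z" using z(3) by simp
  show "Digamma y \<le> ln y" unfolding ln using assms z by (intro Digamma_real_mono) auto
  have "ln y \<le> Digamma (y + 1)" unfolding ln using assms z by (intro Digamma_real_mono) auto
  thus "ln y - 1 / y \<le> Digamma y" using assms by (simp add: Digamma_plus1)
qed

definition real_HZ :: "real \<Rightarrow> real" where
  "real_HZ x = (\<Sum>n. (Digamma (real (Suc n) * x) - ln (real (Suc n) * x)) / real (Suc n))"

definition deriv_HZ :: "real \<Rightarrow> real" where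
  "deriv_HZ x = (\<Sum>n. Polygamma 1 (real (Suc n) * x) - 1 / (real (Suc n) * x))"

lemma summable_real_HZ:
  assumes "x > 0"
  shows "summable (\<lambda>n. (Digamma (real (Suc n) * x) - ln (real (Suc n) * x)) / real (Suc n))"
proof (rule summable_comparison_test')
  show "summable (\<lambda>n. x * (real (Suc n) * x) powr (- 2))"
    using assms by (intro summable_mult summable_Suc_mult_powr) auto
  fix n
  have "\<bar>Digamma u - ln u\<bar> \<le> 1 / u" if "u > 0" for u :: real
    using Digamma_bounds[OF that] that by simp
  from this[of "real (Suc n) * x"] assms
  have "\<bar>Digamma (real (Suc n) * x) - ln (real (Suc n) * x)\<bar> / real (Suc n) \<le> 1 / (real (Suc n) * x) / real (Suc n)"
    by (intro divide_right_mono) auto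
  also have "1 / (N * x) / N = x * (N * x) powr (- 2)" if "N > 0" for N
    using assms that by (simp add: powr_minus powr_numeral power2_eq_square field_simps)
  from this[of "real (Suc n)"]
  have "1 / (real (Suc n) * x) / real (Suc n) = x * (real (Suc n) * x) powr (- 2)" by simp
  finally show "norm ((Digamma (real (Suc n) * x) - ln (real (Suc n) * x)) / real (Suc n)) \<le> x * (real (Suc n) * x) powr (- 2)"
    by simp
qed

lemma HZ_of_real:
  assumes "x > 0"
  shows "HZ (of_real x) = of_real (real_HZ x)"
proof -
  have "(\<lambda>n. of_real ((Digamma (real (Suc n) * x) - ln (real (Suc n) * x)) / real (Suc n)) :: complex) sums
          of_real (real_HZ x)"
    unfolding sums_of_real_iff real_HZ_def using assms by (intro summable_sums summable_real_HZ)
  also have "(\<lambda>n. of_real ((Digamma (real (Suc n) * x) - ln (real (Suc n) * x)) / real (Suc n)) :: complex) =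
               (\<lambda>n. (Digamma (of_nat (Suc n) * of_real x) - Ln (of_nat (Suc n) * of_real x)) / of_nat (Suc n))"
  proof
    fix n
    have "of_nat (Suc n) * of_real x = (of_real (real (Suc n) * x) :: complex)" by simp
    moreover have "real (Suc n) * x > 0" using assms by simp
    ultimately show "of_real ((Digamma (real (Suc n) * x) - ln (real (Suc n) * x)) / real (Suc n)) =
            (Digamma (of_nat (Suc n) * of_real x) - Ln (of_nat (Suc n) * of_real x) :: complex) / of_nat (Suc n)"
      by (simp only: Polygamma_of_real Ln_of_real less_imp_neq [symmetric] of_real_diff of_real_divide of_real_of_nat_eq)
         (metis Ln_of_real Polygamma_of_real less_imp_neq)
  qed
  finally show ?thesis unfolding HZ_def by (rule sums_unique [symmetric])
qed

lemma has_field_derivative_real_HZ: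
  assumes x: "x > 0"
  shows "(real_HZ has_field_derivative deriv_HZ x) (at x)"
proof -
  have "((\<lambda>x. \<Sum>n. (Digamma (real (Suc n) * x) - ln (real (Suc n) * x)) / real (Suc n)) has_field_derivative
          (\<Sum>n. Polygamma 1 (real (Suc n) * x) - 1 / (real (Suc n) * x))) (at x)"
  proof (rule has_field_derivative_series'(2) [where S = "{x / 2..}" and ?x0.0 = x])
    show "((\<lambda>t. (Digamma (real (Suc n) * t) - ln (real (Suc n) * t)) / real (Suc n)) has_field_derivative
            Polygamma 1 (real (Suc n) * t) - 1 / (real (Suc n) * t)) (at t within {x / 2..})"
      if "t \<in> {x / 2..}" for n t
    proof -
      have t: "t > 0" "real (Suc n) * t > 0" using that x by auto
      hence "real (Suc n) * t \<notin> \<int>\<^sub>\<le>\<^sub>0" by (meson nonpos_Ints_nonpos not_less)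
      thus ?thesis using t
        by (auto intro!: derivative_eq_intros simp: field_simps simp del: of_nat_Suc)
    qed
    show "uniformly_convergent_on {x / 2..} (\<lambda>n t. \<Sum>i<n. Polygamma 1 (real (Suc i) * t) - 1 / (real (Suc i) * t))"
    proof (rule Weierstrass_m_test')
      show "summable (\<lambda>n. (real (Suc n) * (x / 2)) powr (- 2))"
        using x by (intro summable_Suc_mult_powr) auto
      fix n t assume "t \<in> {x / 2..}"
      hence t: "real (Suc n) * t > 0" "real (Suc n) * (x / 2) > 0" "real (Suc n) * (x / 2) \<le> real (Suc n) * t"
        using x by auto
      have "\<bar>Polygamma 1 u - 1 / u\<bar> \<le> u powr (- 2)" if "u > 0" for u :: real
        using hurwitz_bounds[of 2 u] that by (simp add: hurwitz_2 powr_minus divide_inverse)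
      hence "\<bar>Polygamma 1 (real (Suc n) * t) - 1 / (real (Suc n) * t)\<bar> \<le> (real (Suc n) * t) powr (- 2)"
        using t(1) .
      also have "\<dots> \<le> (real (Suc n) * (x / 2)) powr (- 2)"
        using t by (intro powr_mono2') auto
      finally show "norm (Polygamma 1 (real (Suc n) * t) - 1 / (real (Suc n) * t)) \<le> (real (Suc n) * (x / 2)) powr (- 2)"
        by simp
    qed
    show "summable (\<lambda>n. (Digamma (real (Suc n) * x) - ln (real (Suc n) * x)) / real (Suc n))"
      using x by (rule summable_real_HZ)
  qed (use x in auto)
  thus ?thesis unfolding real_HZ_def [abs_def] deriv_HZ_def .
qed

text \<open>
  The exact identity for the exponent \<open>2 + s\<close>, multiplied by \<open>l\<close>, is split into the part \<open>E\<close> that is regular at \<open>s = 0\<close> and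
  the part containing \<open>\<zeta>(1 + s)\<close>. The latter has a coefficient \<open>B\<close> with \<open>B 0 = 0\<close>, because the numbers
  \<open>w M = l / ((a x + c) (b x + d)) = a / (a x + c) - b / (b x + d)\<close> have the telescoping sum \<open>(l + 1) / x\<close>. Since
  \<open>s \<zeta>(1 + s)\<close> tends to \<open>1\<close>, it contributes, up to the sign, the derivative of \<open>B\<close> at \<open>0\<close> in the limit, which
  consists of logarithms.
\<close>

lemma deriv_HZ_hecke:
  assumes l: "prime l" and x: "x > 0"
  shows "(\<Sum>(a, b, c, d)\<in>reduced_quads l.
            real l / (of_int b * x + of_int d)\<^sup>2 * deriv_HZ (quad_moebius (a, b, c, d) x)
            - (of_int a / (of_int a * x + of_int c) - of_int b / (of_int b * x + of_int d)) * ln (of_int a * x + of_int c))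
          = (real l + 1) * deriv_HZ x - (real l + 1) * ln x / x - ln (real l) / x"
proof -
  have l0: "real l > 0" using l by (simp add: prime_gt_0_nat)
  define X where "X = (\<lambda>(a :: int, b :: int, c :: int, d :: int). of_int a * x + of_int c)"
  define X' where "X' = (\<lambda>(a :: int, b :: int, c :: int, d :: int). of_int b * x + of_int d)"
  define w where "w = (\<lambda>M. real l / (X M * X' M))"
  define R where "R = reduced_quads l"
  have pos: "X M > 0" "X' M > 0" if "M \<in> R" for M
  proof -
    obtain a b c d where M: "M = (a, b, c, d)" by (cases M)
    have red: "0 \<le> b" "b < a" "0 \<le> c" "c < d" using that by (auto simp: M R_def reduced_quads_def)
    show "X M > 0" unfolding X_def M prod.case using red x by (intro add_pos_nonneg mult_pos_pos) auto
    show "X' M > 0" unfolding X'_def M prod.case using red x by (intro add_nonneg_pos mult_nonneg_nonneg) auto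
  qed
  have w: "w M = of_int a / (of_int a * x + of_int c) - of_int b / (of_int b * x + of_int d)"
    if "M \<in> R" "M = (a, b, c, d)" for M a b c d
  proof -
    have "of_int (a * d - b * c) = real l" using that by (simp add: R_def reduced_quads_def)
    thus ?thesis using pos[OF that(1)]
      by (simp add: w_def X_def X'_def that(2) field_simps)
  qed
  have sum_w: "(\<Sum>M\<in>R. w M) = (real l + 1) / x"
  proof -
    have "(\<Sum>M\<in>R. w M) = (\<Sum>(a, b, c, d)\<in>reduced_quads l. of_int a / (of_int a * x + of_int c) - of_int b / (of_int b * x + of_int d))"
      unfolding R_def by (rule sum.cong) (auto simp: w R_def)
    also have "\<dots> = (real l + 1) / x"
      using sum_columns_telescope[OF l, of "\<lambda>a c. of_int a / (of_int a * x + of_int c)"] l0 x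
      by (simp add: field_simps)
    finally show ?thesis .
  qed
  define A where "A = (\<lambda>s. hurwitz (1 + s) 1)"
  define E where "E = (\<lambda>s t. cone_zeta (2 + s) t - t powr (- 1 - s) * A s / (1 + s))"
  define B where "B = (\<lambda>s. (\<Sum>M\<in>R. w M * X M powr (- s)) - (real l + real l powr (- s)) * x powr (- 1 - s))"
  have E: "((\<lambda>s. E s t) \<longlongrightarrow> deriv_HZ t) (at_right 0)" if "t > 0" for t
    using tendsto_cone_zeta[OF that] by (simp add: E_def A_def deriv_HZ_def)
  have "((\<lambda>s. (\<Sum>M\<in>R. real l * X' M powr (- (2 + s)) * E s (X M / X' M)) - (real l + real l powr (- s)) * E s x) \<longlongrightarrow>
          (\<Sum>M\<in>R. real l * X' M powr (- (2 + 0)) * deriv_HZ (X M / X' M)) - (real l + real l powr (- 0)) * deriv_HZ x) (at_right 0)"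
  proof (intro tendsto_diff tendsto_sum tendsto_mult E)
    show "X M / X' M > 0" if "M \<in> R" for M using pos[OF that] by simp
    show "((\<lambda>s. X' M powr (- (2 + s))) \<longlongrightarrow> X' M powr (- (2 + 0))) (at_right 0)" if "M \<in> R" for M
      using pos[OF that] by (intro tendsto_intros) auto
    show "((\<lambda>s. real l + real l powr (- s)) \<longlongrightarrow> real l + real l powr (- 0)) (at_right 0)"
      using l0 by (intro tendsto_intros) auto
  qed (use x in auto)
  moreover have "((\<lambda>s. (\<Sum>M\<in>R. real l * X' M powr (- (2 + s)) * E s (X M / X' M)) - (real l + real l powr (- s)) * E s x) \<longlongrightarrow>
          - (((\<Sum>M\<in>R. w M * (- ln (X M))) + ln (real l) / x + (real l + 1) * ln x / x) * (1 / (1 + 0)))) (at_right 0)"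
  proof (rule Lim_transform_eventually)
    have "((\<lambda>s. w M * X M powr (- s)) has_field_derivative w M * (- ln (X M))) (at 0)" if "M \<in> R" for M
      using pos[OF that] by (auto intro!: derivative_eq_intros)
    hence "((\<lambda>s. \<Sum>M\<in>R. w M * X M powr (- s)) has_field_derivative (\<Sum>M\<in>R. w M * (- ln (X M)))) (at 0)"
      by (rule DERIV_sum)
    moreover have "((\<lambda>s. (real l + real l powr (- s)) * x powr (- 1 - s)) has_field_derivative
                     - (ln (real l) / x + (real l + 1) * ln x / x)) (at 0)"
      using l0 x by (auto intro!: derivative_eq_intros simp: powr_minus field_simps)
    ultimately have "(B has_field_derivative
            (\<Sum>M\<in>R. w M * (- ln (X M))) + ln (real l) / x + (real l + 1) * ln x / x) (at 0)"
      unfolding B_def by (rule DERIV_cong [OF DERIV_diff]) simp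
    moreover have "B 0 = 0"
    proof -
      have "B 0 = (\<Sum>M\<in>R. w M * X M powr (- 0)) - (real l + real l powr (- 0)) * x powr (- 1 - 0)"
        by (simp only: B_def)
      also have "(\<Sum>M\<in>R. w M * X M powr (- 0)) = (\<Sum>M\<in>R. w M)"
        using pos by (intro sum.cong) (auto simp: less_imp_neq[symmetric])
      also have "(\<Sum>M\<in>R. w M) - (real l + real l powr (- 0)) * x powr (- 1 - 0) = 0"
        using l0 x by (simp add: sum_w powr_minus field_simps)
      finally show ?thesis .
    qed
    ultimately have B: "((\<lambda>s. B s / s) \<longlongrightarrow> (\<Sum>M\<in>R. w M * (- ln (X M))) + ln (real l) / x + (real l + 1) * ln x / x) (at_right 0)"
      unfolding has_field_derivative_iff by (simp add: filterlim_at_split)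
    show "((\<lambda>s. - ((B s / s) * ((s * A s) / (1 + s)))) \<longlongrightarrow>
            - (((\<Sum>M\<in>R. w M * (- ln (X M))) + ln (real l) / x + (real l + 1) * ln x / x) * (1 / (1 + 0)))) (at_right 0)"
      unfolding A_def by (intro tendsto_intros B tendsto_hurwitz_pole) auto
    show "\<forall>\<^sub>F s in at_right 0. - ((B s / s) * ((s * A s) / (1 + s))) =
            (\<Sum>M\<in>R. real l * X' M powr (- (2 + s)) * E s (X M / X' M)) - (real l + real l powr (- s)) * E s x"
      using eventually_at_right_0_1
    proof eventually_elim
      case (elim s)
      define k where "k = A s / (1 + s)"
      have "(\<Sum>M\<in>R. real l * (X' M powr (- (2 + s)) * cone_zeta (2 + s) (X M / X' M))) =
              real l * ((1 + real l powr (1 - (2 + s))) * cone_zeta (2 + s) x)"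
        unfolding sum_distrib_left [symmetric]
        using cone_zeta_hecke[OF l _ x, of "2 + s"] elim
        by (simp add: R_def X_def X'_def quad_moebius_def case_prod_unfold)
      also have "real l powr (1 - (2 + s)) = real l powr (- s) / real l"
        using l0 by (simp add: powr_diff powr_minus field_simps)
      also have "real l * ((1 + real l powr (- s) / real l) * cone_zeta (2 + s) x) =
                   (real l + real l powr (- s)) * cone_zeta (2 + s) x"
        using l0 by (simp add: field_simps)
      finally have H: "(\<Sum>M\<in>R. real l * X' M powr (- (2 + s)) * cone_zeta (2 + s) (X M / X' M)) =
                         (real l + real l powr (- s)) * cone_zeta (2 + s) x"
        by (simp only: mult.assoc)
      have "(\<Sum>M\<in>R. real l * X' M powr (- (2 + s)) * ((X M / X' M) powr (- 1 - s) * k)) =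
            (\<Sum>M\<in>R. w M * X M powr (- s) * k)"
      proof (rule sum.cong [OF refl])
        fix M assume "M \<in> R"
        note p = pos[OF this]
        have "real l * X' M powr (- (2 + s)) * (X M / X' M) powr (- 1 - s) = w M * X M powr (- s)"
          using p by (simp add: w_def powr_divide powr_minus powr_diff powr_add powr_numeral field_simps power2_eq_square)
        thus "real l * X' M powr (- (2 + s)) * ((X M / X' M) powr (- 1 - s) * k) = w M * X M powr (- s) * k"
          by (simp add: mult_ac)
      qed
      hence "(\<Sum>M\<in>R. real l * X' M powr (- (2 + s)) * E s (X M / X' M)) - (real l + real l powr (- s)) * E s x = - (B s * k)"
        using H by (simp add: E_def k_def [symmetric] right_diff_distrib sum_subtractf B_def left_diff_distrib
                              sum_distrib_right times_divide_eq_right [symmetric] del: times_divide_eq_right)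
      thus ?case using elim by (simp add: k_def)
    qed
  qed
  ultimately have "(\<Sum>M\<in>R. real l * X' M powr (- (2 + 0)) * deriv_HZ (X M / X' M)) - (real l + real l powr (- 0)) * deriv_HZ x
        = - (((\<Sum>M\<in>R. w M * (- ln (X M))) + ln (real l) / x + (real l + 1) * ln x / x) * (1 / (1 + 0)))"
    by (rule tendsto_unique [rotated]) simp
  hence "(\<Sum>M\<in>R. real l * X' M powr (- 2) * deriv_HZ (X M / X' M) - w M * ln (X M)) =
           (real l + 1) * deriv_HZ x - (real l + 1) * ln x / x - ln (real l) / x"
    using l0 by (simp add: sum_subtractf sum_negf)
  also have "(\<Sum>M\<in>R. real l * X' M powr (- 2) * deriv_HZ (X M / X' M) - w M * ln (X M)) =
    (\<Sum>(a, b, c, d)\<in>reduced_quads l.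
            real l / (of_int b * x + of_int d)\<^sup>2 * deriv_HZ (quad_moebius (a, b, c, d) x)
            - (of_int a / (of_int a * x + of_int c) - of_int b / (of_int b * x + of_int d)) * ln (of_int a * x + of_int c))"
    unfolding R_def
  proof (rule sum.cong [OF refl])
    fix M assume M: "M \<in> reduced_quads l"
    obtain a b c d where abcd: "M = (a, b, c, d)" by (cases M)
    have "X' M powr (- 2) = 1 / (X' M)\<^sup>2"
      using pos(2)[of M] M by (simp add: R_def powr_minus powr_numeral divide_inverse)
    thus "real l * X' M powr (- 2) * deriv_HZ (X M / X' M) - w M * ln (X M) =
      (case M of (a, b, c, d) \<Rightarrow> real l / (of_int b * x + of_int d)\<^sup>2 * deriv_HZ (quad_moebius (a, b, c, d) x)
            - (of_int a / (of_int a * x + of_int c) - of_int b / (of_int b * x + of_int d)) * ln (of_int a * x + of_int c))"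
      using w[of M a b c d] M by (simp add: abcd R_def X_def X'_def quad_moebius_def)
  qed
  finally show ?thesis .
qed

section \<open>The Rogers dilogarithm on the unit interval\<close>

lemma Li2_has_derivative:
  assumes "0 < t" "t < 1"
  shows "(Li2 has_field_derivative - ln (1 - t) / t) (at t)"
proof -
  have sums: "(\<lambda>n. t ^ n / real (Suc n)) sums (- ln (1 - t) / t)"
  proof -
    have "(\<lambda>n. - ((- (- t)) ^ n) / real n) sums ln (1 + (- t))"
      using assms by (intro ln_series') auto
    hence "(\<lambda>n. - (t ^ Suc n) / real (Suc n)) sums (ln (1 - t) - (- (t ^ 0) / real 0))"
      by (subst sums_Suc_iff) simp
    hence "(\<lambda>n. - (t ^ Suc n) / real (Suc n) * (- 1 / t)) sums (ln (1 - t) * (- 1 / t))"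
      by (intro sums_mult2) simp
    thus ?thesis using assms by (simp add: field_simps del: of_nat_Suc)
  qed
  have "((\<lambda>x. \<Sum>n. 1 / (real (Suc n))\<^sup>2 * x ^ Suc n) has_field_derivative
          (\<Sum>n. 1 / (real (Suc n))\<^sup>2 * real (Suc n) * t ^ n)) (at t)"
  proof (rule DERIV_power_series')
    show "t \<in> {-1<..<1}" using assms by auto
    show "summable (\<lambda>n. 1 / (real (Suc n))\<^sup>2 * real (Suc n) * x ^ n)" if "x \<in> {-1<..<1}" for x :: real
    proof (rule summable_comparison_test')
      show "summable (\<lambda>n. \<bar>x\<bar> ^ n)" using that by (intro summable_geometric) auto
      have "1 / N\<^sup>2 * N * \<bar>x\<bar> ^ n \<le> \<bar>x\<bar> ^ n" if "N \<ge> 1" for N :: real and n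
        using that by (simp add: power2_eq_square mult_left_le_one_le divide_le_eq)
          (metis mult.commute mult_right_mono mult_1 zero_le_power abs_ge_zero)
      from this[of "real (Suc n)" n for n]
      show "norm (1 / (real (Suc n))\<^sup>2 * real (Suc n) * x ^ n) \<le> \<bar>x\<bar> ^ n" for n
        by (simp add: abs_mult power_abs)
    qed
  qed simp
  also have "(\<lambda>x. \<Sum>n. 1 / (real (Suc n))\<^sup>2 * x ^ Suc n) = Li2"
    by (simp add: Li2_def fun_eq_iff)
  also have "(\<Sum>n. 1 / (real (Suc n))\<^sup>2 * real (Suc n) * t ^ n) = - ln (1 - t) / t"
    using sums by (simp add: sums_iff power2_eq_square)
  finally show ?thesis .
qed

lemma rogers_L_has_derivative:
  assumes "0 < t" "t < 1"
  shows "(rogers_L has_field_derivative - (ln (1 - t) / t + ln t / (1 - t)) / 2) (at t)"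
proof -
  have "((\<lambda>t. Li2 t + ln t * ln (1 - t) / 2) has_field_derivative
          - ln (1 - t) / t + (1 / t * ln (1 - t) + ln t * (- 1 / (1 - t))) / 2) (at t)"
    using assms by (auto intro!: derivative_eq_intros Li2_has_derivative simp: mult.commute)
  moreover have "\<forall>\<^sub>F s in nhds t. Li2 s + ln s * ln (1 - s) / 2 = rogers_L s"
    using eventually_nhds_in_open[of "{..<1}" t] assms
    by (auto simp: rogers_L_def elim!: eventually_mono)
  ultimately have "(rogers_L has_field_derivative
          - ln (1 - t) / t + (1 / t * ln (1 - t) + ln t * (- 1 / (1 - t))) / 2) (at t)"
    by (subst (asm) DERIV_cong_ev [OF refl _ refl]) auto
  also have "- ln (1 - t) / t + (1 / t * ln (1 - t) + ln t * (- 1 / (1 - t))) / 2 =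
               - (ln (1 - t) / t + ln t / (1 - t)) / 2"
  proof -
    define p q where "p = ln (1 - t) / t" and "q = ln t / (1 - t)"
    have "- ln (1 - t) / t = - p" "1 / t * ln (1 - t) = p" "ln t * (- 1 / (1 - t)) = - q"
      by (simp_all add: p_def q_def)
    thus ?thesis unfolding p_def [symmetric] q_def [symmetric] by simp
  qed
  finally show ?thesis .
qed

text \<open>
  This is where \<open>\<zeta>(2)\<close> enters: \<open>Li\<^sub>2(1) = \<zeta>(2)\<close>, whereas the product of logarithms vanishes in the limit.
\<close>

lemma tendsto_rogers_L_1: "(rogers_L \<longlongrightarrow> pi\<^sup>2 / 6) (at_left 1)"
proof -
  have ev: "\<forall>\<^sub>F t in at_left (1 :: real). 0 < t \<and> t < 1"
    by (rule eventually_at_leftI [of 0]) auto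
  have "((\<lambda>t :: real. \<Sum>n. t ^ Suc n / (real (Suc n))\<^sup>2) \<longlongrightarrow> (\<Sum>n. 1 ^ Suc n / (real (Suc n))\<^sup>2)) (at_left 1)"
  proof (rule tannerys_theorem [THEN conjunct2, THEN conjunct2])
    show "((\<lambda>t :: real. t ^ Suc n / (real (Suc n))\<^sup>2) \<longlongrightarrow> 1 ^ Suc n / (real (Suc n))\<^sup>2) (at_left 1)" for n
      by (intro tendsto_intros) auto
    show "summable (\<lambda>n. 1 / (real (Suc n))\<^sup>2)"
      using inverse_squares_sums by (simp add: sums_iff add.commute)
    have "norm (t ^ Suc n / (real (Suc n))\<^sup>2) \<le> 1 / (real (Suc n))\<^sup>2" if "0 < t \<and> t < 1" for t :: real and n
    proof -
      have "t ^ Suc n \<le> 1" using that by (intro power_le_one) auto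
      thus ?thesis using that by (simp add: divide_right_mono del: power_Suc of_nat_Suc)
    qed
    thus "\<forall>\<^sub>F (n, t) in sequentially \<times>\<^sub>F at_left (1 :: real). norm (t ^ Suc n / (real (Suc n))\<^sup>2) \<le> 1 / (real (Suc n))\<^sup>2"
      using eventually_prodI [OF always_eventually [of "\<lambda>_. True"] ev, of sequentially]
      by (auto elim!: eventually_mono simp del: power_Suc of_nat_Suc)
  qed auto
  also have "(\<Sum>n. 1 ^ Suc n / (real (Suc n))\<^sup>2) = pi\<^sup>2 / 6"
    using inverse_squares_sums by (simp add: sums_iff add.commute)
  finally have "(Li2 \<longlongrightarrow> pi\<^sup>2 / 6) (at_left 1)" by (simp add: Li2_def [abs_def])
  moreover have "((\<lambda>t :: real. ln t * ln (1 - t) / 2) \<longlongrightarrow> 0) (at_left 1)" by real_asymp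
  ultimately have "((\<lambda>t. Li2 t + ln t * ln (1 - t) / 2) \<longlongrightarrow> pi\<^sup>2 / 6 + 0) (at_left 1)"
    by (rule tendsto_add)
  moreover have "\<forall>\<^sub>F t in at_left 1. Li2 t + ln t * ln (1 - t) / 2 = rogers_L t"
    using ev by eventually_elim (simp add: rogers_L_def)
  ultimately have "(rogers_L \<longlongrightarrow> pi\<^sup>2 / 6 + 0) (at_left 1)"
    by (rule Lim_transform_eventually)
  thus ?thesis by simp
qed

section \<open>Derivative and diagonal limit of the refined function\<close>

definition real_HZ_tilde :: "real \<Rightarrow> real" where
  "real_HZ_tilde x = real_HZ x - real_HZ 1 + pi\<^sup>2 / 12 * (x - 2 + inverse x) - (ln x)\<^sup>2 / 4"

definition real_refined_HZ :: "real \<Rightarrow> real \<Rightarrow> real" where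
  "real_refined_HZ x y = real_HZ_tilde x - real_HZ_tilde y + rogers_L (y / x)"

lemma refined_HZ_of_real:
  assumes "x > 0" "y > 0"
  shows "refined_HZ x y = of_real (real_refined_HZ x y)"
proof -
  have "HZ_tilde (of_real t) = of_real (real_HZ_tilde t)" if "t > 0" for t
    using that HZ_of_real[of t] HZ_of_real[of 1] by (simp add: HZ_tilde_def real_HZ_tilde_def Ln_of_real)
  thus ?thesis using assms by (simp add: refined_HZ_def real_refined_HZ_def)
qed

lemma has_field_derivative_real_HZ_tilde:
  assumes "x > 0"
  shows "(real_HZ_tilde has_field_derivative
           (deriv_HZ x + pi\<^sup>2 / 12 * (1 - 1 / x\<^sup>2) - ln x / (2 * x))) (at x)"
  unfolding real_HZ_tilde_def [abs_def] using assms
  by (auto intro!: derivative_eq_intros has_field_derivative_real_HZ [THEN DERIV_chain2]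
           simp: power2_eq_square field_simps)

text \<open>
  The derivative of \<open>real_refined_HZ u v\<close> along a curve through \<open>u\<close> with speed \<open>u'\<close>, for fixed \<open>v\<close>.
\<close>

definition refined_slope :: "real \<Rightarrow> real \<Rightarrow> real \<Rightarrow> real" where
  "refined_slope u u' v = u' * (deriv_HZ u + pi\<^sup>2 / 12 * (1 - 1 / u\<^sup>2) - ln u / (2 * u))
     + u' / (2 * u) * (ln (1 - v / u) + v / (u - v) * ln (v / u))"

lemma has_field_derivative_real_refined_HZ:
  assumes "0 < v" "v < u x" and u: "(u has_field_derivative u') (at x)"
  shows "((\<lambda>x. real_refined_HZ (u x) v) has_field_derivative refined_slope (u x) u' v) (at x)"
proof -
  have "((\<lambda>x. real_HZ_tilde (u x)) has_field_derivative
           (deriv_HZ (u x) + pi\<^sup>2 / 12 * (1 - 1 / (u x)\<^sup>2) - ln (u x) / (2 * u x)) * u') (at x)"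
    using assms by (intro DERIV_chain2 [OF has_field_derivative_real_HZ_tilde]) auto
  moreover have "((\<lambda>x. rogers_L (v / u x)) has_field_derivative
      - (ln (1 - v / u x) / (v / u x) + ln (v / u x) / (1 - v / u x)) / 2 * (- v * u' / (u x)\<^sup>2)) (at x)"
    using assms by (intro DERIV_chain2 [OF rogers_L_has_derivative])
      (auto intro!: derivative_eq_intros simp: power2_eq_square)
  moreover have "- (ln (1 - v / u x) / (v / u x) + ln (v / u x) / (1 - v / u x)) / 2 * (- v * u' / (u x)\<^sup>2) =
                   u' / (2 * u x) * (ln (1 - v / u x) + v / (u x - v) * ln (v / u x))"
  proof -
    define p where "p = ln (1 - v / u x)"
    define q where "q = ln (v / u x)"
    show ?thesis unfolding p_def [symmetric] q_def [symmetric]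
      using assms by (simp add: field_simps power2_eq_square)
  qed
  ultimately show ?thesis unfolding real_refined_HZ_def refined_slope_def
    by (auto intro!: derivative_eq_intros simp: mult_ac)
qed

text \<open>
  The difference of the one-variable functions is antisymmetric in \<open>x\<close> and \<open>y\<close>, so this is the reflection formula of the dilogarithm.
\<close>

lemma real_refined_HZ_swap:
  assumes "0 < x" "x < y"
  shows "real_refined_HZ x y = pi\<^sup>2 / 3 - real_refined_HZ y x"
  using rogers_L_gt_1[of "y / x"] assms by (simp add: real_refined_HZ_def)

section \<open>The Hecke action on the refined function\<close>

text \<open>
  Let \<open>\<xi>, \<xi>'\<close> be numerator and denominator of the Moebius transformation at \<open>x\<close>, and \<open>\<eta>, \<eta>'\<close> those at
  \<open>y\<close>. Up to terms in \<open>l\<close> and \<open>x - y\<close>, all logarithms split into those of \<open>\<xi>, \<xi>', \<eta>, \<eta>'\<close>, because \<open>\<xi> \<eta>' - \<eta> \<xi>' = l (x - y)\<close>. After separating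
  the terms to which \<open>deriv_HZ_hecke\<close> applies, the terms in \<open>\<xi>, \<eta>\<close> depend on the first column and those in
  \<open>\<xi>', \<eta>'\<close> depend in the same way on the second column, with the opposite sign. Thus the rest telescopes.
\<close>

lemma refined_slope_hecke:
  assumes l: "prime l" and y: "0 < y" "y < x"
  shows "(\<Sum>M\<in>reduced_quads l. refined_slope (quad_moebius M x)
             (case M of (a, b, c, d) \<Rightarrow> real l / (of_int b * x + of_int d)\<^sup>2) (quad_moebius M y)) =
           (real l + 1) * refined_slope x 1 y + (real l - 1) / 2 * ln (real l) / x"
proof -
  have l0: "real l > 0" using l by (simp add: prime_gt_0_nat)
  have x: "x > 0" using y by simp
  define \<delta> where "\<delta> = 1 / (x - y)"
  \<comment> \<open>The contribution of a single column to what remains after separating \<open>deriv_HZ\<close> and its logarithm.\<close>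
  define g :: "int \<Rightarrow> int \<Rightarrow> real" where
    "g = (\<lambda>a c. (of_int a / (of_int a * x + of_int c) - \<delta>) / 2 * (ln (of_int a * x + of_int c) - ln (of_int a * y + of_int c))
                + of_int a / (of_int a * x + of_int c) / 2 * (ln (real l) + ln (x - y))
                - pi\<^sup>2 / 12 * real l / (of_int a * x + of_int c)\<^sup>2)"
  have summand: "refined_slope (quad_moebius M x) (real l / (of_int b * x + of_int d)\<^sup>2) (quad_moebius M y) =
          (real l / (of_int b * x + of_int d)\<^sup>2 * deriv_HZ (quad_moebius (a, b, c, d) x)
            - (of_int a / (of_int a * x + of_int c) - of_int b / (of_int b * x + of_int d)) * ln (of_int a * x + of_int c))
            + (g a c - g b d)"
    if M: "M \<in> reduced_quads l" "M = (a, b, c, d)" for M a b c d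
  proof -
    define \<xi> \<xi>' \<eta> \<eta>' where eqs: "\<xi> = of_int a * x + of_int c" "\<xi>' = of_int b * x + of_int d"
      "\<eta> = of_int a * y + of_int c" "\<eta>' = of_int b * y + of_int d"
    have pos: "\<xi> > 0" "\<xi>' > 0" "\<eta> > 0" "\<eta>' > 0"
      unfolding eqs using moebius_denominator_pos M x y(1) by blast+
    have moeb: "quad_moebius (a, b, c, d) x = \<xi> / \<xi>'" "quad_moebius (a, b, c, d) y = \<eta> / \<eta>'"
      by (simp_all add: quad_moebius_def eqs)
    have det': "of_int a * of_int d - of_int b * of_int c = real l"
      using reduced_det M by blast
    have cross: "\<xi> * \<eta>' - \<eta> * \<xi>' = real l * (x - y)"
      unfolding eqs det' [symmetric] by (simp add: algebra_simps)
    have w: "of_int a / \<xi> - of_int b / \<xi>' = real l / (\<xi> * \<xi>')"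
    proof -
      have "of_int a * \<xi>' - of_int b * \<xi> = real l"
        unfolding eqs det' [symmetric] by (simp add: algebra_simps)
      thus ?thesis using pos by (simp add: field_simps)
    qed
    have "1 - \<eta> / \<eta>' / (\<xi> / \<xi>') = (\<xi> * \<eta>' - \<eta> * \<xi>') / (\<xi> * \<eta>')"
      using pos by (simp add: field_simps)
    hence ln1: "ln (1 - \<eta> / \<eta>' / (\<xi> / \<xi>')) = ln (real l) + ln (x - y) - ln \<xi> - ln \<eta>'"
      using pos l0 y by (simp add: cross ln_div ln_mult)
    have ln2: "ln (\<eta> / \<eta>' / (\<xi> / \<xi>')) = ln \<eta> - ln \<eta>' - ln \<xi> + ln \<xi>'" "ln (\<xi> / \<xi>') = ln \<xi> - ln \<xi>'"
      using pos by (simp_all add: ln_div ln_mult)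
    have "\<xi> / \<xi>' - \<eta> / \<eta>' = (\<xi> * \<eta>' - \<eta> * \<xi>') / (\<xi>' * \<eta>')"
      using pos by (simp add: field_simps)
    hence "(\<eta> / \<eta>') / (\<xi> / \<xi>' - \<eta> / \<eta>') = \<eta> * \<xi>' / (real l * (x - y))"
      using pos l0 y by (simp add: cross)
    hence "real l / (\<xi> * \<xi>') * ((\<eta> / \<eta>') / (\<xi> / \<xi>' - \<eta> / \<eta>')) = \<eta> / (\<xi> * (x - y))"
      using pos l0 by simp
    also have "\<dots> = \<delta> - of_int a / \<xi>"
    proof -
      have "\<eta> = \<xi> - of_int a * (x - y)" by (simp add: eqs algebra_simps)
      thus ?thesis using pos y by (simp add: \<delta>_def field_simps)
    qed
    \<comment> \<open>The second column drops out of this coefficient, which is what separates the columns.\<close>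
    finally have coeff: "(of_int a / \<xi> - of_int b / \<xi>') * ((\<eta> / \<eta>') / (\<xi> / \<xi>' - \<eta> / \<eta>')) = \<delta> - of_int a / \<xi>"
      by (simp add: w)
    have half: "real l / \<xi>'\<^sup>2 / (2 * (\<xi> / \<xi>')) = (of_int a / \<xi> - of_int b / \<xi>') / 2"
      unfolding w using pos by (simp add: field_simps power2_eq_square)
    have sq: "real l / \<xi>'\<^sup>2 * (pi\<^sup>2 / 12 * (1 - 1 / (\<xi> / \<xi>')\<^sup>2)) =
                pi\<^sup>2 / 12 * real l / \<xi>'\<^sup>2 - pi\<^sup>2 / 12 * real l / \<xi>\<^sup>2"
      using pos by (simp add: field_simps)
    define P where "P = of_int a / \<xi> - of_int b / \<xi>'"
    define t where "t = (\<eta> / \<eta>') / (\<xi> / \<xi>' - \<eta> / \<eta>')"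
    have "refined_slope (\<xi> / \<xi>') (real l / \<xi>'\<^sup>2) (\<eta> / \<eta>') =
            real l / \<xi>'\<^sup>2 * deriv_HZ (\<xi> / \<xi>') + real l / \<xi>'\<^sup>2 * (pi\<^sup>2 / 12 * (1 - 1 / (\<xi> / \<xi>')\<^sup>2))
            - real l / \<xi>'\<^sup>2 / (2 * (\<xi> / \<xi>')) * ln (\<xi> / \<xi>')
            + real l / \<xi>'\<^sup>2 / (2 * (\<xi> / \<xi>')) * (ln (1 - \<eta> / \<eta>' / (\<xi> / \<xi>')) + t * ln (\<eta> / \<eta>' / (\<xi> / \<xi>')))"
      unfolding refined_slope_def t_def by (simp only: distrib_left right_diff_distrib mult.assoc times_divide_eq_left times_divide_eq_right mult_ac)
    also have "\<dots> = real l / \<xi>'\<^sup>2 * deriv_HZ (\<xi> / \<xi>') + (pi\<^sup>2 / 12 * real l / \<xi>'\<^sup>2 - pi\<^sup>2 / 12 * real l / \<xi>\<^sup>2)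
                      - P / 2 * (ln \<xi> - ln \<xi>') + P / 2 * (ln (real l) + ln (x - y) - ln \<xi> - ln \<eta>')
                      + (P * t) / 2 * (ln \<eta> - ln \<eta>' - ln \<xi> + ln \<xi>')"
      unfolding half sq ln1 ln2 P_def [symmetric]
      by (simp add: algebra_simps add_divide_distrib diff_divide_distrib)
    also have "P * t = \<delta> - of_int a / \<xi>" unfolding P_def t_def by (rule coeff)
    finally have G: "refined_slope (\<xi> / \<xi>') (real l / \<xi>'\<^sup>2) (\<eta> / \<eta>') =
        real l / \<xi>'\<^sup>2 * deriv_HZ (\<xi> / \<xi>') + (pi\<^sup>2 / 12 * real l / \<xi>'\<^sup>2 - pi\<^sup>2 / 12 * real l / \<xi>\<^sup>2)
                      - P / 2 * (ln \<xi> - ln \<xi>') + P / 2 * (ln (real l) + ln (x - y) - ln \<xi> - ln \<eta>')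
                      + (\<delta> - of_int a / \<xi>) / 2 * (ln \<eta> - ln \<eta>' - ln \<xi> + ln \<xi>')" .
    define A where "A = of_int a / \<xi>"
    define B where "B = of_int b / \<xi>'"
    have g: "g a c = (A - \<delta>) / 2 * (ln \<xi> - ln \<eta>) + A / 2 * (ln (real l) + ln (x - y)) - pi\<^sup>2 / 12 * real l / \<xi>\<^sup>2"
      "g b d = (B - \<delta>) / 2 * (ln \<xi>' - ln \<eta>') + B / 2 * (ln (real l) + ln (x - y)) - pi\<^sup>2 / 12 * real l / \<xi>'\<^sup>2"
      by (simp_all add: g_def A_def B_def eqs)
    have "P = A - B" by (simp add: P_def A_def B_def)
    show ?thesis
      unfolding M(2) moeb eqs [symmetric] G g A_def [symmetric] B_def [symmetric] \<open>P = A - B\<close>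
      by (simp add: field_simps)
  qed
  have "(\<Sum>M\<in>reduced_quads l. refined_slope (quad_moebius M x)
             (case M of (a, b, c, d) \<Rightarrow> real l / (of_int b * x + of_int d)\<^sup>2) (quad_moebius M y)) =
          (\<Sum>(a, b, c, d)\<in>reduced_quads l.
            (real l / (of_int b * x + of_int d)\<^sup>2 * deriv_HZ (quad_moebius (a, b, c, d) x)
            - (of_int a / (of_int a * x + of_int c) - of_int b / (of_int b * x + of_int d)) * ln (of_int a * x + of_int c))
            + (g a c - g b d))"
    by (rule sum.cong) (auto simp: summand)
  also have "\<dots> = (\<Sum>(a, b, c, d)\<in>reduced_quads l.
            real l / (of_int b * x + of_int d)\<^sup>2 * deriv_HZ (quad_moebius (a, b, c, d) x)
            - (of_int a / (of_int a * x + of_int c) - of_int b / (of_int b * x + of_int d)) * ln (of_int a * x + of_int c))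
            + (\<Sum>(a, b, c, d)\<in>reduced_quads l. g a c - g b d)"
    by (simp add: case_prod_unfold sum.distrib)
  also have "\<dots> = (real l + 1) * deriv_HZ x - (real l + 1) * ln x / x - ln (real l) / x
                  + (real l * g (int l) 0 + g 1 0 - g 0 1 - real l * g 0 (int l))"
    unfolding deriv_HZ_hecke[OF l x] sum_columns_telescope[OF l] ..
  also have "real l * g (int l) 0 + g 1 0 - g 0 1 - real l * g 0 (int l) =
               (real l + 1) * ((1 / x - \<delta>) / 2 * (ln x - ln y) + (ln (real l) + ln (x - y)) / (2 * x) + pi\<^sup>2 / 12 * (1 - 1 / x\<^sup>2))"
  proof -
    define K where "K = (1 / x - \<delta>) / 2 * (ln x - ln y) + (ln (real l) + ln (x - y)) / (2 * x)"
    have "g (int l) 0 = K - pi\<^sup>2 / 12 / (real l * x\<^sup>2)"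
      using l0 x y by (simp add: g_def K_def ln_mult power_mult_distrib power2_eq_square mult_ac)
    hence "real l * g (int l) 0 = real l * K - pi\<^sup>2 / 12 / x\<^sup>2"
      using l0 by (simp add: right_diff_distrib)
    moreover have "g 1 0 = K - pi\<^sup>2 / 12 * real l / x\<^sup>2"
      by (simp add: g_def K_def)
    moreover have "g 0 1 = - pi\<^sup>2 / 12 * real l" by (simp add: g_def)
    moreover have "real l * g 0 (int l) = - pi\<^sup>2 / 12" using l0 by (simp add: g_def power2_eq_square)
    ultimately show ?thesis
      unfolding K_def [symmetric] by (simp add: algebra_simps add_divide_distrib diff_divide_distrib)
  qed
  also have "(real l + 1) * deriv_HZ x - (real l + 1) * ln x / x - ln (real l) / x + \<dots> =
               (real l + 1) * refined_slope x 1 y + (real l - 1) / 2 * ln (real l) / x"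
  proof -
    define r where "r = 1 / x"
    define Q where "Q = pi\<^sup>2 / 12 * (1 - 1 / x\<^sup>2)"
    have lns: "ln (1 - y / x) = ln (x - y) - ln x" "ln (y / x) = ln y - ln x"
      using x y ln_div[of "x - y" x] by (simp_all add: ln_div diff_divide_distrib)
    have ratio: "y / (x - y) = x * \<delta> - 1" using y by (simp add: \<delta>_def field_simps)
    have slope: "refined_slope x 1 y =
        deriv_HZ x + Q - ln x * r / 2 + (ln (x - y) - ln x) * r / 2 + (\<delta> - r) / 2 * (ln y - ln x)"
      unfolding refined_slope_def lns ratio Q_def [symmetric] using x by (simp add: r_def field_simps)
    have quotients: "(real l + 1) * ln x / x = (real l + 1) * ln x * r" "ln (real l) / x = ln (real l) * r"
      "(ln (real l) + ln (x - y)) / (2 * x) = (ln (real l) + ln (x - y)) * r / 2"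
      "(real l - 1) / 2 * ln (real l) / x = (real l - 1) / 2 * ln (real l) * r"
      by (simp_all add: r_def)
    show ?thesis
      unfolding slope quotients Q_def [symmetric] unfolding r_def [symmetric]
      by (simp add: algebra_simps add_divide_distrib diff_divide_distrib)
  qed
  finally show ?thesis .
qed

text \<open>
  On the diagonal the one-variable functions cancel, which leaves \<open>L(1)\<close>.
\<close>

lemma tendsto_real_refined_HZ_diagonal:
  assumes v: "v > 0" and u: "(u \<longlongrightarrow> v) F" "\<forall>\<^sub>F t in F. v < u t"
  shows "((\<lambda>t. real_refined_HZ (u t) v) \<longlongrightarrow> pi\<^sup>2 / 6) F"
proof -
  have "isCont real_HZ_tilde v"
    using has_field_derivative_real_HZ_tilde[OF v] by (rule DERIV_isCont)
  hence "((\<lambda>t. real_HZ_tilde (u t)) \<longlongrightarrow> real_HZ_tilde v) F"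
    using u(1) by (rule isCont_tendsto_compose)
  moreover have "((\<lambda>t. rogers_L (v / u t)) \<longlongrightarrow> pi\<^sup>2 / 6) F"
  proof (rule filterlim_compose [OF tendsto_rogers_L_1])
    have "((\<lambda>t. v / u t) \<longlongrightarrow> v / v) F" using u(1) v by (intro tendsto_intros) auto
    moreover have "\<forall>\<^sub>F t in F. v / u t \<in> {..<1} \<and> v / u t \<noteq> 1"
      using u(2) by eventually_elim (use v in auto)
    ultimately show "filterlim (\<lambda>t. v / u t) (at_left 1) F"
      using v by (auto simp: filterlim_at elim!: eventually_mono)
  qed
  ultimately have "((\<lambda>t. real_HZ_tilde (u t) - real_HZ_tilde v + rogers_L (v / u t)) \<longlongrightarrow>
                     real_HZ_tilde v - real_HZ_tilde v + pi\<^sup>2 / 6) F"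
    by (intro tendsto_intros)
  thus ?thesis by (simp add: real_refined_HZ_def)
qed

text \<open>
  The difference \<open>\<Delta>\<close> of the two sides is constant on \<open>(y, \<infinity>)\<close>, hence equal to its limit at \<open>y\<close>, to which
  every value of the refined function contributes \<open>\<pi>\<^sup>2 / 6\<close>.
\<close>

lemma real_refined_HZ_hecke:
  assumes l: "prime l" and y: "0 < y" "y < x"
  shows "(\<Sum>M\<in>reduced_quads l. real_refined_HZ (quad_moebius M x) (quad_moebius M y)) =
           (real l + 1) * real_refined_HZ x y + (real l - 1) / 2 * ln (real l) * ln (x / y)
           + (real (card (reduced_quads l)) - (real l + 1)) * (pi\<^sup>2 / 6)"
proof -
  have l0: "l > 0" using l by (rule prime_gt_0_nat)
  define \<Delta> where "\<Delta> = (\<lambda>t. (\<Sum>M\<in>reduced_quads l. real_refined_HZ (quad_moebius M t) (quad_moebius M y))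
            - ((real l + 1) * real_refined_HZ t y + (real l - 1) / 2 * ln (real l) * ln (t / y)))"
  have deriv: "(\<Delta> has_field_derivative 0) (at t)" if t: "y < t" for t
  proof -
    have "((\<lambda>t. real_refined_HZ (quad_moebius M t) (quad_moebius M y)) has_field_derivative
             refined_slope (quad_moebius M t) (case M of (a, b, c, d) \<Rightarrow> real l / (of_int b * t + of_int d)\<^sup>2) (quad_moebius M y)) (at t)"
      if M: "M \<in> reduced_quads l" for M
    proof (rule has_field_derivative_real_refined_HZ)
      show "(quad_moebius M has_field_derivative (case M of (a, b, c, d) \<Rightarrow> real l / (of_int b * t + of_int d)\<^sup>2)) (at t)"
        using moebius_has_derivative M t y(1) by (cases M) auto
    qed (use M l0 t y in \<open>auto intro: moebius_pos moebius_strict_mono\<close>)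
    hence "((\<lambda>t. \<Sum>M\<in>reduced_quads l. real_refined_HZ (quad_moebius M t) (quad_moebius M y)) has_field_derivative
             (\<Sum>M\<in>reduced_quads l. refined_slope (quad_moebius M t) (case M of (a, b, c, d) \<Rightarrow> real l / (of_int b * t + of_int d)\<^sup>2) (quad_moebius M y))) (at t)"
      by (rule DERIV_sum)
    also have "(\<Sum>M\<in>reduced_quads l. refined_slope (quad_moebius M t) (case M of (a, b, c, d) \<Rightarrow> real l / (of_int b * t + of_int d)\<^sup>2) (quad_moebius M y))
       = (real l + 1) * refined_slope t 1 y + (real l - 1) / 2 * ln (real l) / t"
      using refined_slope_hecke[OF l y(1) t] .
    finally have 1: "((\<lambda>t. \<Sum>M\<in>reduced_quads l. real_refined_HZ (quad_moebius M t) (quad_moebius M y)) has_field_derivative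
       (real l + 1) * refined_slope t 1 y + (real l - 1) / 2 * ln (real l) / t) (at t)" .
    have 2: "((\<lambda>t. real_refined_HZ t y) has_field_derivative refined_slope t 1 y) (at t)"
      by (rule has_field_derivative_real_refined_HZ) (use y t in auto)
    have 3: "((\<lambda>t. ln (t / y)) has_field_derivative 1 / t) (at t)"
      using y t by (auto intro!: derivative_eq_intros)
    show ?thesis unfolding \<Delta>_def
      using DERIV_diff [OF 1 DERIV_add [OF DERIV_cmult [OF 2, of "real l + 1"]
                                           DERIV_cmult [OF 3, of "(real l - 1) / 2 * ln (real l)"]]]
      by simp
  qed
  have "((\<lambda>t. real_refined_HZ (quad_moebius M t) (quad_moebius M y)) \<longlongrightarrow> pi\<^sup>2 / 6) (at_right y)"
    if M: "M \<in> reduced_quads l" for M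
  proof (rule tendsto_real_refined_HZ_diagonal)
    show "quad_moebius M y > 0" using M y(1) by (rule moebius_pos)
    obtain a b c d where "M = (a, b, c, d)" by (cases M)
    hence "isCont (quad_moebius M) y"
      using moebius_has_derivative[of a b c d l y] M y(1) by (auto intro: DERIV_isCont)
    thus "(quad_moebius M \<longlongrightarrow> quad_moebius M y) (at_right y)"
      by (auto simp: isCont_def filterlim_at_split)
    have "\<forall>\<^sub>F t in at_right y. y < t" by (simp add: eventually_at_right_less)
    thus "\<forall>\<^sub>F t in at_right y. quad_moebius M y < quad_moebius M t"
      by eventually_elim (use M l0 y in \<open>auto intro: moebius_strict_mono\<close>)
  qed
  moreover have "((\<lambda>t. real_refined_HZ t y) \<longlongrightarrow> pi\<^sup>2 / 6) (at_right y)"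
    using y(1) by (rule tendsto_real_refined_HZ_diagonal) (auto simp: eventually_at_right_less)
  ultimately have "(\<Delta> \<longlongrightarrow> (\<Sum>M\<in>reduced_quads l. pi\<^sup>2 / 6) - ((real l + 1) * (pi\<^sup>2 / 6) + (real l - 1) / 2 * ln (real l) * ln (y / y))) (at_right y)"
    unfolding \<Delta>_def using y by (intro tendsto_intros) auto
  moreover have "\<forall>\<^sub>F t in at_right y. \<Delta> t = \<Delta> x"
  proof -
    have "\<Delta> t = \<Delta> x" if "t > y" for t
      using that y by (intro DERIV_isconst3 [of y "max x t + 1" t x \<Delta>] deriv) auto
    thus ?thesis by (auto intro: eventually_mono [OF eventually_at_right_less])
  qed
  ultimately have "((\<lambda>_. \<Delta> x) \<longlongrightarrow> (\<Sum>M\<in>reduced_quads l. pi\<^sup>2 / 6) - ((real l + 1) * (pi\<^sup>2 / 6) + (real l - 1) / 2 * ln (real l) * ln (y / y))) (at_right y)"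
    by (rule Lim_transform_eventually)
  hence "\<Delta> x = (\<Sum>M\<in>reduced_quads l. pi\<^sup>2 / 6) - ((real l + 1) * (pi\<^sup>2 / 6) + (real l - 1) / 2 * ln (real l) * ln (y / y))"
    by (simp add: tendsto_const_iff)
  thus ?thesis using y by (simp add: \<Delta>_def algebra_simps add_divide_distrib diff_divide_distrib)
qed

text \<open>
  Exchanging \<open>x\<close> and \<open>y\<close> negates every term except for the constant, up to a summand \<open>\<pi>\<^sup>2 / 3\<close> for each
  value of the refined function. As \<open>- \<pi>\<^sup>2 / 6 + \<pi>\<^sup>2 / 3 = \<pi>\<^sup>2 / 6\<close>, the constant is the same for both orders.
\<close>

lemma real_refined_HZ_hecke_symmetric:
  assumes l: "prime l" and xy: "0 < x" "0 < y" "x \<noteq> y"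
  shows "(\<Sum>M\<in>reduced_quads l. real_refined_HZ (quad_moebius M x) (quad_moebius M y)) =
           (real l + 1) * real_refined_HZ x y + (real l - 1) / 2 * ln (real l) * ln (x / y)
           + (real (card (reduced_quads l)) - (real l + 1)) * (pi\<^sup>2 / 6)"
proof (cases "y < x")
  case True
  thus ?thesis using l xy by (intro real_refined_HZ_hecke) auto
next
  case False
  hence less: "x < y" using xy by simp
  have l0: "l > 0" using l by (rule prime_gt_0_nat)
  have "(\<Sum>M\<in>reduced_quads l. real_refined_HZ (quad_moebius M x) (quad_moebius M y)) =
          (\<Sum>M\<in>reduced_quads l. pi\<^sup>2 / 3 - real_refined_HZ (quad_moebius M y) (quad_moebius M x))"
    using xy l0 less by (intro sum.cong real_refined_HZ_swap moebius_pos moebius_strict_mono) auto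
  also have "\<dots> = real (card (reduced_quads l)) * (pi\<^sup>2 / 3) -
      ((real l + 1) * real_refined_HZ y x + (real l - 1) / 2 * ln (real l) * ln (y / x)
           + (real (card (reduced_quads l)) - (real l + 1)) * (pi\<^sup>2 / 6))"
    using real_refined_HZ_hecke[OF l xy(1) less] by (simp add: sum_subtractf)
  also have "ln (y / x) = - ln (x / y)" using xy by (simp add: ln_div)
  also have "real_refined_HZ y x = pi\<^sup>2 / 3 - real_refined_HZ x y"
    using real_refined_HZ_swap[OF xy(1) less] by simp
  finally show ?thesis by (simp add: algebra_simps add_divide_distrib diff_divide_distrib)
qed

lemma bij_betw_S_set_reduced:
  "bij_betw (\<lambda>M. (M $ 1 $ 1, M $ 1 $ 2, M $ 2 $ 1, M $ 2 $ 2)) (S_set l) (reduced_quads l)"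
proof (rule bij_betw_byWitness [where f' = "\<lambda>(a, b, c, d). vector [vector [a, b], vector [c, d]]"])
qed (auto simp: S_set_def reduced_quads_def det_2 vec_eq_iff forall_2)

theorem corollary1:
  fixes l :: nat and x y :: real
  assumes "prime l" and "x > 0" and "y > 0" and "x \<noteq> y"
  shows "\<exists>k::int.
           slash_theta refined_HZ l x y
           - (of_nat (l + 1) * refined_HZ x y
              + of_real ((real l - 1) / 2 * ln (real l) * ln (x / y)))
           = of_int k * of_real (zeta 2)"
proof -
  define e where "e = (\<lambda>M :: int ^ 2 ^ 2. (M $ 1 $ 1, M $ 1 $ 2, M $ 2 $ 1, M $ 2 $ 2))"
  define k where "k = int (card (reduced_quads l)) - (int l + 1)"
  have "moebius_tr M t = quad_moebius (e M) t" for M t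
    by (simp add: moebius_tr_def quad_moebius_def e_def)
  hence "slash_theta refined_HZ l x y = (\<Sum>M\<in>S_set l. refined_HZ (quad_moebius (e M) x) (quad_moebius (e M) y))"
    by (simp add: slash_theta_def slash_def)
  also have "\<dots> = (\<Sum>M\<in>reduced_quads l. refined_HZ (quad_moebius M x) (quad_moebius M y))"
    using bij_betw_S_set_reduced[of l] unfolding e_def by (rule sum.reindex_bij_betw)
  also have "\<dots> = of_real (\<Sum>M\<in>reduced_quads l. real_refined_HZ (quad_moebius M x) (quad_moebius M y))"
    unfolding of_real_sum using assms by (intro sum.cong refined_HZ_of_real moebius_pos) auto
  finally have "slash_theta refined_HZ l x y = of_real (\<Sum>M\<in>reduced_quads l. real_refined_HZ (quad_moebius M x) (quad_moebius M y))" .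
  moreover have "(\<Sum>M\<in>reduced_quads l. real_refined_HZ (quad_moebius M x) (quad_moebius M y)) =
      (real l + 1) * real_refined_HZ x y + (real l - 1) / 2 * ln (real l) * ln (x / y) + of_int k * zeta 2"
    using real_refined_HZ_hecke_symmetric[OF assms] by (simp add: k_def zeta_2)
  ultimately have "slash_theta refined_HZ l x y
           - (of_nat (l + 1) * refined_HZ x y
              + of_real ((real l - 1) / 2 * ln (real l) * ln (x / y)))
           = of_int k * of_real (zeta 2)"
    using assms by (simp add: refined_HZ_of_real algebra_simps)
  thus ?thesis ..
qed

end
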